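(* Consider the compatible finite element discretisation of the linear shallow water equations on the $f$-plane (that is, $\Omega$ is the periodic plane and the Coriolis parameter $f$ is constant). The only time-varying solutions $(u,h)$ of this discretisation with divergence-free $u$ and $h=0$ are the solutions with spatially constant $u$ satisfying $u_t+fu^\perp=0$. Any time-independent solutions (with divergence-free $u$ and $h=0$) are in the kernel of the discrete Coriolis operator, i.e. $$\int_\Omega w\cdot u^\perp\,dx=0\qquad\text{for all } w\in V_h^1(\Omega).$$
   Context: For a planar vector, $(u_1,u_2)^\perp=(-u_2,u_1)$, and $\nabla^\perp\psi=(-\partial_y\psi,\partial_x\psi)$. Compatible finite element spaces: a sequence of finite element spaces $V_h^0(\Omega)\subset H^1(\Omega)$ and $V_h^2(\Omega)\subset L^2(\Omega)$ of scalar functions and $V_h^1(\Omega)\subset H(\mathrm{div};\Omega)$ of vector fields, such that: (1) $\nabla^\perp\psi\in V_h^1(\Omega)$ for all $\psi\in V_h^0(\Omega)$; (2) $\nabla\cdot u\in V_h^2(\Omega)$ for all $u\in V_h^1(\Omega)$; (3) there exist bounded projections $\pi^0:H^1(\Omega)\to V_h^0(\Omega)$, $\pi^1:H(\mathrm{div};\Omega)\to V_h^1(\Omega)$, $\pi^2:L^2(\Omega)\to V_h^2(\Omega)$ with $\nabla^\perp\pi^0=\pi^1\nabla^\perp$ and $\nabla\cdot\pi^1=\pi^2\,\nabla\cdot$. Discretisation: with $g$ the acceleration due to gravity, $H$ a constant reference depth and $f$ the Coriolis parameter, a solution is a pair of time-dependent functions $u(t)\in V_h^1(\Omega)$ (velocity),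 $h(t)\in V_h^2(\Omega)$ (layer height) such that at every time $$\int_\Omega w\cdot u_t\,dx+\int_\Omega f\,w\cdot u^\perp\,dx-g\int_\Omega(\nabla\cdot w)\,h\,dx=0\quad\forall w\in V_h^1(\Omega),$$ $$\int_\Omega\phi\,(h_t+H\nabla\cdot u)\,dx=0\quad\forall\phi\in V_h^2(\Omega).$$ (The layer height $h$ is unrelated to the subscript $h$ of the spaces.)
   Formalization: Assumes f is nonzero and that constant fields lie in V_h^1; "the only time-varying solutions" is corrected to: every solution with divergence-free u and h=0 is a time-independent one plus a spatially constant one with u_t+fu^perp=0. *)

theory Defs
  imports "HOL-Analysis.Analysis"
begin

section \<open>Function spaces on the periodic plane\<close>

text \<open>
  The periodic plane with periods \<open>Lx\<close>, \<open>Ly\<close> is represented by a fundamental cell. Functions on it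
  are functions on the whole plane that are periodic in both directions, so that no boundary
  conditions appear. Elements of Lebesgue and Sobolev spaces are represented by Borel measurable
  representatives, compared with \<open>ae_eq\<close>.
\<close>

type_synonym plane = "real \<times> real"

definition perp :: "plane \<Rightarrow> plane" where
  "perp v = (- snd v, fst v)"

definition torus :: "real \<Rightarrow> real \<Rightarrow> plane measure" where
  "torus Lx Ly = restrict_space lborel ({0..<Lx} \<times> {0..<Ly})"

definition periodic :: "real \<Rightarrow> real \<Rightarrow> (plane \<Rightarrow> 'b) \<Rightarrow> bool" where
  "periodic Lx Ly u \<longleftrightarrow> (\<forall>x y. u (x + Lx, y) = u (x, y) \<and> u (x, y + Ly) = u (x, y))"

definition ae_eq :: "real \<Rightarrow> real \<Rightarrow> (plane \<Rightarrow> 'b) \<Rightarrow> (plane \<Rightarrow> 'b) \<Rightarrow> bool" where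
  "ae_eq Lx Ly u v \<longleftrightarrow> (AE x in torus Lx Ly. u x = v x)"

definition L2 :: "real \<Rightarrow> real \<Rightarrow> (plane \<Rightarrow> 'b::euclidean_space) set" where
  "L2 Lx Ly = {u \<in> borel_measurable borel.
     periodic Lx Ly u \<and> integrable (torus Lx Ly) (\<lambda>x. (norm (u x))\<^sup>2)}"

definition L2norm :: "real \<Rightarrow> real \<Rightarrow> (plane \<Rightarrow> 'b::euclidean_space) \<Rightarrow> real" where
  "L2norm Lx Ly u = sqrt (LINT x|torus Lx Ly. (norm (u x))\<^sup>2)"

definition grad :: "(plane \<Rightarrow> real) \<Rightarrow> plane \<Rightarrow> plane" where
  "grad \<phi> p = (frechet_derivative \<phi> (at p) (1, 0), frechet_derivative \<phi> (at p) (0, 1))"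

fun Ck :: "nat \<Rightarrow> (plane \<Rightarrow> real) \<Rightarrow> bool" where
  "Ck 0 \<phi> \<longleftrightarrow> continuous_on UNIV \<phi>"
| "Ck (Suc n) \<phi> \<longleftrightarrow> \<phi> differentiable_on UNIV \<and>
     Ck n (\<lambda>p. fst (grad \<phi> p)) \<and> Ck n (\<lambda>p. snd (grad \<phi> p))"

definition test_function :: "real \<Rightarrow> real \<Rightarrow> (plane \<Rightarrow> real) \<Rightarrow> bool" where
  "test_function Lx Ly \<phi> \<longleftrightarrow> periodic Lx Ly \<phi> \<and> (\<forall>n. Ck n \<phi>)"

definition is_weak_grad :: "real \<Rightarrow> real \<Rightarrow> (plane \<Rightarrow> real) \<Rightarrow> (plane \<Rightarrow> plane) \<Rightarrow> bool" where
  "is_weak_grad Lx Ly \<psi> G \<longleftrightarrow> G \<in> L2 Lx Ly \<and>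
     (\<forall>\<phi>. test_function Lx Ly \<phi> \<longrightarrow>
        (LINT x|torus Lx Ly. \<psi> x *\<^sub>R grad \<phi> x) = - (LINT x|torus Lx Ly. \<phi> x *\<^sub>R G x))"

definition is_weak_div :: "real \<Rightarrow> real \<Rightarrow> (plane \<Rightarrow> plane) \<Rightarrow> (plane \<Rightarrow> real) \<Rightarrow> bool" where
  "is_weak_div Lx Ly u d \<longleftrightarrow> d \<in> L2 Lx Ly \<and>
     (\<forall>\<phi>. test_function Lx Ly \<phi> \<longrightarrow>
        (LINT x|torus Lx Ly. u x \<bullet> grad \<phi> x) = - (LINT x|torus Lx Ly. \<phi> x * d x))"

definition H1 :: "real \<Rightarrow> real \<Rightarrow> (plane \<Rightarrow> real) set" where
  "H1 Lx Ly = {\<psi> \<in> L2 Lx Ly. \<exists>G. is_weak_grad Lx Ly \<psi> G}"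

definition Hdiv :: "real \<Rightarrow> real \<Rightarrow> (plane \<Rightarrow> plane) set" where
  "Hdiv Lx Ly = {u \<in> L2 Lx Ly. \<exists>d. is_weak_div Lx Ly u d}"

text \<open>
  Weak derivatives are unique up to \<open>ae_eq\<close>. The choices below are only meaningful on
  \<open>H1\<close> and \<open>Hdiv\<close> respectively.
\<close>

definition wgrad :: "real \<Rightarrow> real \<Rightarrow> (plane \<Rightarrow> real) \<Rightarrow> plane \<Rightarrow> plane" where
  "wgrad Lx Ly \<psi> = (SOME G. is_weak_grad Lx Ly \<psi> G)"

definition perp_grad :: "real \<Rightarrow> real \<Rightarrow> (plane \<Rightarrow> real) \<Rightarrow> plane \<Rightarrow> plane" where
  "perp_grad Lx Ly \<psi> x = perp (wgrad Lx Ly \<psi> x)"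

definition wdiv :: "real \<Rightarrow> real \<Rightarrow> (plane \<Rightarrow> plane) \<Rightarrow> plane \<Rightarrow> real" where
  "wdiv Lx Ly u = (SOME d. is_weak_div Lx Ly u d)"

definition H1norm :: "real \<Rightarrow> real \<Rightarrow> (plane \<Rightarrow> real) \<Rightarrow> real" where
  "H1norm Lx Ly \<psi> = sqrt ((L2norm Lx Ly \<psi>)\<^sup>2 + (L2norm Lx Ly (wgrad Lx Ly \<psi>))\<^sup>2)"

definition Hdivnorm :: "real \<Rightarrow> real \<Rightarrow> (plane \<Rightarrow> plane) \<Rightarrow> real" where
  "Hdivnorm Lx Ly u = sqrt ((L2norm Lx Ly u)\<^sup>2 + (L2norm Lx Ly (wdiv Lx Ly u))\<^sup>2)"

section \<open>Compatible finite element spaces\<close>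

text \<open>
  A finite element space is taken to be any finite-dimensional linear subspace of the ambient space
  \<open>X\<close>. It contains all representatives in \<open>X\<close> of each of its elements, so membership does not
  depend on the choice of representative.
\<close>

definition fe_space ::
    "real \<Rightarrow> real \<Rightarrow> (plane \<Rightarrow> 'b::euclidean_space) set \<Rightarrow> (plane \<Rightarrow> 'b) set \<Rightarrow> bool" where
  "fe_space Lx Ly X V \<longleftrightarrow>
     V \<subseteq> X \<and> (\<lambda>x. 0) \<in> V \<and>
     (\<forall>u\<in>V. \<forall>v\<in>V. (\<lambda>x. u x + v x) \<in> V) \<and>
     (\<forall>u\<in>V. \<forall>a. (\<lambda>x. a *\<^sub>R u x) \<in> V) \<and>
     (\<forall>u\<in>V. \<forall>v\<in>X. ae_eq Lx Ly u v \<longrightarrow> v \<in> V) \<and>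
     (\<exists>B. finite B \<and> B \<subseteq> V \<and> (\<forall>v\<in>V. \<exists>a. ae_eq Lx Ly v (\<lambda>x. \<Sum>b\<in>B. a b *\<^sub>R b x)))"

text \<open>\<open>N\<close> is the norm of the ambient space \<open>X\<close>.\<close>

definition bounded_projection ::
    "real \<Rightarrow> real \<Rightarrow> (plane \<Rightarrow> 'b::euclidean_space) set \<Rightarrow> ((plane \<Rightarrow> 'b) \<Rightarrow> real) \<Rightarrow>
     (plane \<Rightarrow> 'b) set \<Rightarrow> ((plane \<Rightarrow> 'b) \<Rightarrow> (plane \<Rightarrow> 'b)) \<Rightarrow> bool" where
  "bounded_projection Lx Ly X N V P \<longleftrightarrow>
     (\<forall>u\<in>X. P u \<in> V) \<and>
     (\<forall>u\<in>X. \<forall>v\<in>X. \<forall>a b.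
        ae_eq Lx Ly (P (\<lambda>x. a *\<^sub>R u x + b *\<^sub>R v x)) (\<lambda>x. a *\<^sub>R P u x + b *\<^sub>R P v x)) \<and>
     (\<forall>v\<in>V. ae_eq Lx Ly (P v) v) \<and>
     (\<exists>C. \<forall>u\<in>X. N (P u) \<le> C * N u)"

definition compatible_fe_spaces ::
    "real \<Rightarrow> real \<Rightarrow> (plane \<Rightarrow> real) set \<Rightarrow> (plane \<Rightarrow> plane) set \<Rightarrow> (plane \<Rightarrow> real) set \<Rightarrow> bool" where
  "compatible_fe_spaces Lx Ly V0 V1 V2 \<longleftrightarrow>
     fe_space Lx Ly (H1 Lx Ly) V0 \<and>
     fe_space Lx Ly (Hdiv Lx Ly) V1 \<and>
     fe_space Lx Ly (L2 Lx Ly) V2 \<and>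
     (\<forall>\<psi>\<in>V0. perp_grad Lx Ly \<psi> \<in> V1) \<and>
     (\<forall>u\<in>V1. wdiv Lx Ly u \<in> V2) \<and>
     (\<exists>P0 P1 P2.
        bounded_projection Lx Ly (H1 Lx Ly) (H1norm Lx Ly) V0 P0 \<and>
        bounded_projection Lx Ly (Hdiv Lx Ly) (Hdivnorm Lx Ly) V1 P1 \<and>
        bounded_projection Lx Ly (L2 Lx Ly) (L2norm Lx Ly) V2 P2 \<and>
        (\<forall>\<psi>\<in>H1 Lx Ly. ae_eq Lx Ly (perp_grad Lx Ly (P0 \<psi>)) (P1 (perp_grad Lx Ly \<psi>))) \<and>
        (\<forall>u\<in>Hdiv Lx Ly. ae_eq Lx Ly (wdiv Lx Ly (P1 u)) (P2 (wdiv Lx Ly u))))"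

section \<open>The discrete linear shallow water equations\<close>

text \<open>
  Time ranges over an interval \<open>T\<close>, and time derivatives are limits of difference quotients in
  the \<open>L2\<close> norm (one-sided at endpoints of \<open>T\<close>). On a finite-dimensional space all norms give
  the same notion.
\<close>

definition has_time_deriv ::
    "real \<Rightarrow> real \<Rightarrow> real set \<Rightarrow> (real \<Rightarrow> plane \<Rightarrow> 'b::euclidean_space) \<Rightarrow> (plane \<Rightarrow> 'b) \<Rightarrow> real \<Rightarrow> bool" where
  "has_time_deriv Lx Ly T u ut t \<longleftrightarrow> ut \<in> L2 Lx Ly \<and>
     ((\<lambda>s. L2norm Lx Ly (\<lambda>x. (1 / (s - t)) *\<^sub>R (u s x - u t x) - ut x)) \<longlongrightarrow> 0) (at t within T)"

definition swe_solution ::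
    "real \<Rightarrow> real \<Rightarrow> (plane \<Rightarrow> plane) set \<Rightarrow> (plane \<Rightarrow> real) set \<Rightarrow> real \<Rightarrow> real \<Rightarrow> (plane \<Rightarrow> real) \<Rightarrow>
     real set \<Rightarrow> (real \<Rightarrow> plane \<Rightarrow> plane) \<Rightarrow> (real \<Rightarrow> plane \<Rightarrow> real) \<Rightarrow> bool" where
  "swe_solution Lx Ly V1 V2 g H f T u h \<longleftrightarrow>
     (\<forall>t\<in>T. u t \<in> V1 \<and> h t \<in> V2 \<and>
        (\<exists>ut ht. has_time_deriv Lx Ly T u ut t \<and> has_time_deriv Lx Ly T h ht t \<and>
           (\<forall>w\<in>V1. (LINT x|torus Lx Ly. w x \<bullet> ut x)
                    + (LINT x|torus Lx Ly. f x * (w x \<bullet> perp (u t x)))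
                    - g * (LINT x|torus Lx Ly. wdiv Lx Ly w x * h t x) = 0) \<and>
           (\<forall>\<phi>\<in>V2. (LINT x|torus Lx Ly. \<phi> x * (ht x + H * wdiv Lx Ly (u t) x)) = 0)))"

definition divfree_flat_solution ::
    "real \<Rightarrow> real \<Rightarrow> (plane \<Rightarrow> plane) set \<Rightarrow> (plane \<Rightarrow> real) set \<Rightarrow> real \<Rightarrow> real \<Rightarrow> (plane \<Rightarrow> real) \<Rightarrow>
     real set \<Rightarrow> (real \<Rightarrow> plane \<Rightarrow> plane) \<Rightarrow> (real \<Rightarrow> plane \<Rightarrow> real) \<Rightarrow> bool" where
  "divfree_flat_solution Lx Ly V1 V2 g H f T u h \<longleftrightarrow>
     swe_solution Lx Ly V1 V2 g H f T u h \<and>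
     (\<forall>t\<in>T. ae_eq Lx Ly (wdiv Lx Ly (u t)) (\<lambda>x. 0) \<and> ae_eq Lx Ly (h t) (\<lambda>x. 0))"

definition time_independent :: "real \<Rightarrow> real \<Rightarrow> real set \<Rightarrow> (real \<Rightarrow> plane \<Rightarrow> 'b) \<Rightarrow> bool" where
  "time_independent Lx Ly T u \<longleftrightarrow> (\<forall>s\<in>T. \<forall>t\<in>T. ae_eq Lx Ly (u s) (u t))"

definition spatially_constant :: "real \<Rightarrow> real \<Rightarrow> (plane \<Rightarrow> 'b) \<Rightarrow> bool" where
  "spatially_constant Lx Ly v \<longleftrightarrow> (\<exists>c. ae_eq Lx Ly v (\<lambda>x. c))"

definition inertial_oscillation ::
    "real \<Rightarrow> real \<Rightarrow> real \<Rightarrow> real set \<Rightarrow> (real \<Rightarrow> plane \<Rightarrow> plane) \<Rightarrow> bool" where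
  "inertial_oscillation Lx Ly f T u \<longleftrightarrow>
     (\<forall>t\<in>T. spatially_constant Lx Ly (u t) \<and>
        (\<exists>ut. has_time_deriv Lx Ly T u ut t \<and>
              ae_eq Lx Ly (\<lambda>x. ut x + f *\<^sub>R perp (u t x)) (\<lambda>x. 0)))"

definition coriolis_kernel ::
    "real \<Rightarrow> real \<Rightarrow> (plane \<Rightarrow> plane) set \<Rightarrow> (plane \<Rightarrow> plane) set" where
  "coriolis_kernel Lx Ly V1 =
     {u \<in> V1. \<forall>w\<in>V1. (LINT x|torus Lx Ly. w x \<bullet> perp (u x)) = 0}"

end

theory Submission
  imports Defs
begin

text \<open>
  If \<open>z\<close> and \<open>u\<close> are square-integrable and weakly divergence-free on the torus and \<open>z\<close> has zero mean,
  then \<open>z\<close> is an \<open>L2\<close> limit of rotated gradients of trigonometric polynomials, so \<open>z\<close> is orthogonal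
  to \<open>perp u\<close>. Testing the momentum equation with such \<open>z \<in> V1\<close> therefore shows that the inner
  product of \<open>z\<close> and \<open>u t\<close> does not depend on time; for \<open>z\<close> the mean-free part of \<open>u s - u t\<close> this gives
  that \<open>u s - u t\<close> is constant in space. The spatial mean of \<open>u\<close> then carries all the time dependence
  and performs an inertial oscillation, and the remaining steady part is in the Coriolis kernel.
\<close>

section \<open>Preliminaries\<close>

text \<open>Rotation is an isometry: a rotated gradient paired with \<open>perp u\<close> equals a
  gradient paired with \<open>u\<close>, and this vanishes because \<open>u\<close> is weakly
  divergence-free. The harmonic fields on the torus are exactly the constants, the single
  obstruction to writing a divergence-free field as a rotated gradient. This is why the mean is
  split off, and why constants have to lie in \<open>V1\<close>: the mean-free part of
  \<open>u s - u t\<close> must be an admissible test function.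

  The fields in \<open>V1\<close> are merely square-integrable, hence the detour through
  trigonometric polynomials. On a single Fourier mode the Helmholtz decomposition is linear algebra
  with the wave vector, and density in \<open>L2\<close> comes from approximating indicators of
  quadrants, with no elliptic theory.

  Time derivatives are limits in the \<open>L2\<close> norm, so the evolution is followed through
  scalar functions \<open>ip w (u s)\<close>, to which calculus on an interval applies. Splitting
  off the steady part also uses that derivatives are unique, which holds because \<open>T\<close>
  has no isolated points.\<close>

lemma norm_add_sq_le: "(norm (a + b))\<^sup>2 \<le> 2 * (norm a)\<^sup>2 + 2 * (norm (b::'b::real_inner))\<^sup>2"
proof -
  have "(norm (a + b))\<^sup>2 + (norm (a - b))\<^sup>2 = 2 * (norm a)\<^sup>2 + 2 * (norm b)\<^sup>2"
    unfolding power2_norm_eq_inner by (simp add: algebra_simps inner_commute)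
  then show ?thesis by (smt (verit) zero_le_power2)
qed

lemma real_sq_add_le: "(a + b)\<^sup>2 \<le> 2 * a\<^sup>2 + 2 * (b::real)\<^sup>2"
  using norm_add_sq_le[of a b] by simp

text \<open>No sign of \<open>W\<close> is assumed: if \<open>W\<close> is not positive,
  \<open>e = 1\<close> already forces \<open>x = 0\<close>.\<close>

lemma eq_0_if_le_eps:
  fixes x W :: real
  assumes "\<And>e. 0 < e \<Longrightarrow> \<bar>x\<bar> \<le> e * W" shows "x = 0"
proof (rule ccontr)
  assume "x \<noteq> 0"
  show False
  proof (cases "0 < W")
    case True
    then show False using assms[of "\<bar>x\<bar> / (2 * W)"] \<open>x \<noteq> 0\<close> by simp
  next
    case False
    then show False using assms[of 1] \<open>x \<noteq> 0\<close> by simp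
  qed
qed

lemma eventually_in_within: "\<forall>\<^sub>F s in at t within T. s \<in> T"
  by (simp add: eventually_at_filter)

lemma bounded_linear_perp: "bounded_linear perp"
  unfolding perp_def[abs_def] by (intro bounded_linear_Pair bounded_linear_minus
    bounded_linear_fst bounded_linear_snd)

lemma perp_add: "perp (a + b) = perp a + perp b"
  by (simp add: perp_def)

lemma perp_diff: "perp (a - b) = perp a - perp b"
  by (simp add: perp_def)

lemma perp_scaleR: "perp (r *\<^sub>R a) = r *\<^sub>R perp a"
  by (simp add: perp_def)

section \<open>Calculus of \<open>grad\<close> and of the cosine\<close>

lemma grad_const: "grad (\<lambda>v. c) v = 0"
  by (simp add: grad_def zero_prod_def)

lemma grad_add:
  assumes "p differentiable (at v)" "q differentiable (at v)"
  shows "grad (\<lambda>v. p v + q v) v = grad p v + grad q v"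
proof -
  from assms have "((\<lambda>v. p v + q v) has_derivative
      (\<lambda>h. frechet_derivative p (at v) h + frechet_derivative q (at v) h)) (at v)"
    by (intro has_derivative_add) (simp_all flip: frechet_derivative_works)
  from frechet_derivative_at[OF this, symmetric] show ?thesis
    by (simp add: grad_def)
qed

lemma grad_mult:
  assumes "p differentiable (at v)" "q differentiable (at v)"
  shows "grad (\<lambda>v. p v * q v) v = p v *\<^sub>R grad q v + q v *\<^sub>R grad p v"
proof -
  from assms have "((\<lambda>v. p v * q v) has_derivative
      (\<lambda>h. p v * frechet_derivative q (at v) h + frechet_derivative p (at v) h * q v)) (at v)"
    by (intro has_derivative_mult) (simp_all flip: frechet_derivative_works)
  from frechet_derivative_at[OF this, symmetric] show ?thesis
    by (simp add: grad_def mult.commute)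
qed

lemma cos_add_2pi_int: "cos (x + 2 * pi * of_int m) = cos x"
  using cos_integer_2pi[of m] sin_integer_2pi[of m] by (simp add: cos_add)

text \<open>The free phase \<open>c\<close> absorbs the other coordinate when an integral over the
  torus is iterated.\<close>

lemma LINT_cos_period:
  assumes "0 < L" "m \<noteq> 0"
  shows "(LINT x|lborel. indicator {0..<L} x *\<^sub>R cos (2 * pi * of_int m / L * x + c)) = 0"
proof -
  let ?k = "2 * pi * of_int m / L"
  have k: "?k \<noteq> 0" using assms by simp
  have "(LINT x|lborel. indicator {0..<L} x *\<^sub>R cos (?k * x + c))
      = (LINT x|lborel. indicator {0..L} x *\<^sub>R cos (?k * x + c))"
    by (rule integral_cong_AE)
       (auto intro!: AE_I[where N = "{L}"] simp: indicator_def split: if_splits)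
  also have "\<dots> = sin (?k * L + c) / ?k - sin (?k * 0 + c) / ?k"
  proof (rule integral_FTC_Icc[where F = "\<lambda>x. sin (?k * x + c) / ?k"])
    show "((\<lambda>x. sin (?k * x + c) / ?k) has_vector_derivative cos (?k * x + c)) (at x within {0..L})" for x
      unfolding has_real_derivative_iff_has_vector_derivative[symmetric] using k
      by (auto intro!: derivative_eq_intros)
  qed (use assms in \<open>auto intro!: continuous_intros\<close>)
  also have "sin (?k * L + c) = sin (c + 2 * pi * of_int m)"
    using assms by (simp add: add.commute)
  also have "\<dots> = sin c"
    using cos_integer_2pi[of m] sin_integer_2pi[of m] by (simp add: sin_add)
  finally show ?thesis by simp
qed

text \<open>The cosine of period \<open>L\<close> centred at \<open>b / 2\<close> takes the value
  \<open>cos (pi * b / L)\<close> at both ends of [0, b]. On [0, L) it lies above that value exactly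
  between them, so the segment is a superlevel set of a trigonometric polynomial.\<close>

lemma initial_segment_iff_cos:
  assumes "0 \<le> b" "b < L" "0 \<le> x" "x < L"
  shows "cos (pi * b / L) \<le> cos (2 * pi / L * x - pi * b / L) \<longleftrightarrow> x \<le> b"
proof -
  define w where "w = pi * b / L"
  define t where "t = 2 * pi / L * x - w"
  have L: "0 < L" using assms by simp
  have w: "0 \<le> w" "w < pi" using assms by (auto simp: w_def field_simps)
  have s: "0 \<le> 2 * pi / L * x" "2 * pi / L * x < 2 * pi"
    using assms L by (auto simp: field_simps)
  have "x \<le> b \<longleftrightarrow> t \<le> w"
    using L by (simp add: t_def w_def field_simps)
  moreover have "cos w \<le> cos t \<longleftrightarrow> t \<le> w"
  proof
    assume "t \<le> w"
    then have "\<bar>t\<bar> \<le> w" using s by (auto simp: t_def)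
    then have "cos w \<le> cos \<bar>t\<bar>" using w by (intro cos_monotone_0_pi_le) auto
    then show "cos w \<le> cos t" by simp
  next
    assume *: "cos w \<le> cos t"
    show "t \<le> w"
    proof (rule ccontr)
      assume "\<not> t \<le> w"
      show False
      proof (cases "t \<le> pi")
        case True
        then show False
          using cos_monotone_0_pi[of w t] * w \<open>\<not> t \<le> w\<close> by simp
      next
        case False
        \<comment> \<open>Beyond \<open>pi\<close>, the reflection \<open>2 * pi - t\<close> falls
          back into the range where cosine decreases. It still exceeds \<open>w\<close>, because
          \<open>x < L\<close> means \<open>t < 2 * pi - w\<close>.\<close>
        then have "cos (2 * pi - t) < cos w"
          using s w by (intro cos_monotone_0_pi) (auto simp: t_def)
        then show False using * by (simp add: cos_diff)
      qed
    qed
  qed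
  ultimately show ?thesis by (simp add: t_def w_def)
qed

section \<open>Square-integrable functions on the torus\<close>

locale periodic_plane =
  fixes Lx Ly :: real
  assumes Lx: "0 < Lx" and Ly: "0 < Ly"
begin

abbreviation M :: "plane measure" where "M \<equiv> torus Lx Ly"

definition ip :: "(plane \<Rightarrow> 'b::euclidean_space) \<Rightarrow> (plane \<Rightarrow> 'b) \<Rightarrow> real" where
  "ip u v = (LINT x|M. u x \<bullet> v x)"

definition area :: real where "area = Lx * Ly"

lemma area_pos: "0 < area"
  using Lx Ly by (simp add: area_def)

lemma space_torus: "space M = {0..<Lx} \<times> {0..<Ly}"
  by (simp add: torus_def space_restrict_space)

lemma sets_cell: "{0..<Lx} \<times> {0..<Ly} \<in> sets borel"
  unfolding borel_prod[symmetric] by (intro pair_measureI) auto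

lemma emeasure_torus: "emeasure M (space M) = ennreal area"
proof -
  have "emeasure M (space M) = emeasure (lborel \<Otimes>\<^sub>M lborel) ({0..<Lx} \<times> {0..<Ly})"
    unfolding space_torus unfolding torus_def
    by (subst emeasure_restrict_space) (auto simp: lborel_prod sets_cell)
  also have "\<dots> = ennreal Lx * ennreal Ly"
    using Lx Ly by (subst lborel.emeasure_pair_measure_Times) auto
  finally show ?thesis
    using Lx Ly by (simp add: area_def ennreal_mult)
qed

sublocale torus: finite_measure M
  by standard (simp add: emeasure_torus)

lemma measure_torus [simp]: "measure M (space M) = area"
  using area_pos by (simp add: measure_def emeasure_torus)

lemma borel_measurable_torus [measurable_dest]:
  "f \<in> borel_measurable borel \<Longrightarrow> f \<in> borel_measurable M"
  unfolding torus_def by (rule measurable_restrict_space1) simp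

lemma L2_measurable: "u \<in> L2 Lx Ly \<Longrightarrow> u \<in> borel_measurable borel"
  by (simp add: L2_def)

lemma L2_measurable_torus: "u \<in> L2 Lx Ly \<Longrightarrow> u \<in> borel_measurable M"
  by (simp add: L2_def borel_measurable_torus)

lemma L2_square_integrable: "u \<in> L2 Lx Ly \<Longrightarrow> integrable M (\<lambda>x. (norm (u x))\<^sup>2)"
  by (simp add: L2_def)

lemma L2_add [intro]:
  assumes "u \<in> L2 Lx Ly" "v \<in> L2 Lx Ly" shows "(\<lambda>x. u x + v x) \<in> L2 Lx Ly"
proof -
  note [measurable] = L2_measurable[OF assms(1)] L2_measurable[OF assms(2)]
  have "integrable M (\<lambda>x. (norm (u x + v x))\<^sup>2)"
  proof (rule Bochner_Integration.integrable_bound)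
    show "integrable M (\<lambda>x. 2 * (norm (u x))\<^sup>2 + 2 * (norm (v x))\<^sup>2)"
      using assms by (auto intro!: L2_square_integrable)
    show "(\<lambda>x. (norm (u x + v x))\<^sup>2) \<in> borel_measurable M"
      by (intro borel_measurable_torus) simp
  qed (auto intro!: order_trans[OF norm_add_sq_le])
  then show ?thesis
    using assms by (simp add: L2_def periodic_def)
qed

lemma L2_bounded_linear:
  assumes T: "bounded_linear T" and u: "u \<in> L2 Lx Ly" shows "(\<lambda>x. T (u x)) \<in> L2 Lx Ly"
proof -
  obtain K where K: "\<And>x. norm (T x) \<le> norm x * K"
    using bounded_linear.bounded[OF T] by blast
  have meas: "(\<lambda>x. T (u x)) \<in> borel_measurable borel"
    by (rule measurable_compose[OF L2_measurable[OF u]])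
       (intro borel_measurable_continuous_onI linear_continuous_on T)
  have "integrable M (\<lambda>x. (norm (T (u x)))\<^sup>2)"
  proof (rule Bochner_Integration.integrable_bound)
    show "integrable M (\<lambda>x. (norm (u x))\<^sup>2 * K\<^sup>2)"
      using L2_square_integrable[OF u] by simp
    show "(\<lambda>x. (norm (T (u x)))\<^sup>2) \<in> borel_measurable M"
      using borel_measurable_torus[OF meas] by simp
    show "AE x in M. norm ((norm (T (u x)))\<^sup>2) \<le> norm ((norm (u x))\<^sup>2 * K\<^sup>2)"
      using K by (auto simp flip: power_mult_distrib intro!: AE_I2 power_mono)
  qed
  then show ?thesis using meas u by (simp add: L2_def periodic_def)
qed

lemma L2_scaleR [intro]: "u \<in> L2 Lx Ly \<Longrightarrow> (\<lambda>x. a *\<^sub>R u x) \<in> L2 Lx Ly"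
  by (rule L2_bounded_linear[OF bounded_linear_scaleR_right])

lemma L2_diff [intro]:
  assumes "u \<in> L2 Lx Ly" "v \<in> L2 Lx Ly" shows "(\<lambda>x. u x - v x) \<in> L2 Lx Ly"
  using L2_add[OF assms(1) L2_scaleR[OF assms(2), of "-1"]] by simp

lemma L2_perp [intro]: "u \<in> L2 Lx Ly \<Longrightarrow> (\<lambda>x. perp (u x)) \<in> L2 Lx Ly"
  by (rule L2_bounded_linear[OF bounded_linear_perp])

lemma L2_bounded:
  assumes meas: "u \<in> borel_measurable borel" and "periodic Lx Ly u" and B: "\<And>x. norm (u x) \<le> B"
  shows "u \<in> L2 Lx Ly"
proof -
  note [measurable] = borel_measurable_torus[OF meas]
  have "integrable M (\<lambda>x. (norm (u x))\<^sup>2)"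
    by (rule torus.integrable_const_bound[where B = "B\<^sup>2"]) (auto intro!: power_mono B)
  then show ?thesis using assms by (simp add: L2_def)
qed

lemma L2_const [intro, simp]: "(\<lambda>x. c) \<in> L2 Lx Ly"
  by (rule L2_bounded[where B = "norm c"]) (auto simp: periodic_def)

lemma integrable_inner:
  assumes "u \<in> L2 Lx Ly" "v \<in> L2 Lx Ly" shows "integrable M (\<lambda>x. u x \<bullet> v x)"
proof (rule Bochner_Integration.integrable_bound)
  note [measurable] = assms[THEN L2_measurable_torus]
  show "integrable M (\<lambda>x. (norm (u x))\<^sup>2 + (norm (v x))\<^sup>2)"
    using assms by (auto intro!: L2_square_integrable)
  show "(\<lambda>x. u x \<bullet> v x) \<in> borel_measurable M" by simp
  have "norm (a \<bullet> b) \<le> norm ((norm a)\<^sup>2 + (norm b)\<^sup>2)" for a b :: 'a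
  proof -
    have "\<bar>a \<bullet> b\<bar> \<le> norm a * norm b" by (rule Cauchy_Schwarz_ineq2)
    also have "\<dots> \<le> (norm a)\<^sup>2 + (norm b)\<^sup>2"
      using sum_squares_bound[of "norm a" "norm b"] 
        mult_nonneg_nonneg[OF norm_ge_zero[of a] norm_ge_zero[of b]] by linarith
    finally show ?thesis by simp
  qed
  then show "AE x in M. norm (u x \<bullet> v x) \<le> norm ((norm (u x))\<^sup>2 + (norm (v x))\<^sup>2)"
    by simp
qed

lemma L2_integrable:
  assumes "u \<in> L2 Lx Ly" shows "integrable M u"
  unfolding integrable_norm_iff[OF L2_measurable_torus[OF assms], symmetric]
proof (rule Bochner_Integration.integrable_bound)
  show "integrable M (\<lambda>x. 1 + (norm (u x))\<^sup>2)"
    using assms by (auto intro!: L2_square_integrable)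
  note [measurable] = L2_measurable_torus[OF assms]
  show "(\<lambda>x. norm (u x)) \<in> borel_measurable M" by simp
  have "a \<le> 1 + a\<^sup>2" if "0 \<le> a" for a :: real
    using sum_squares_bound[of 1 a] that by simp
  then show "AE x in M. norm (norm (u x)) \<le> norm (1 + (norm (u x))\<^sup>2)"
    by auto
qed

lemma ip_commute: "ip u v = ip v u"
  by (simp add: ip_def inner_commute)

lemma ip_add_left: "u \<in> L2 Lx Ly \<Longrightarrow> v \<in> L2 Lx Ly \<Longrightarrow> w \<in> L2 Lx Ly \<Longrightarrow>
    ip (\<lambda>x. u x + v x) w = ip u w + ip v w"
  by (simp add: ip_def inner_add_left integrable_inner)

lemma ip_diff_left: "u \<in> L2 Lx Ly \<Longrightarrow> v \<in> L2 Lx Ly \<Longrightarrow> w \<in> L2 Lx Ly \<Longrightarrow>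
    ip (\<lambda>x. u x - v x) w = ip u w - ip v w"
  by (simp add: ip_def inner_diff_left integrable_inner)

lemma ip_add_right: "u \<in> L2 Lx Ly \<Longrightarrow> v \<in> L2 Lx Ly \<Longrightarrow> w \<in> L2 Lx Ly \<Longrightarrow>
    ip w (\<lambda>x. u x + v x) = ip w u + ip w v"
  by (simp add: ip_def inner_add_right integrable_inner)

lemma ip_diff_right: "u \<in> L2 Lx Ly \<Longrightarrow> v \<in> L2 Lx Ly \<Longrightarrow> w \<in> L2 Lx Ly \<Longrightarrow>
    ip w (\<lambda>x. u x - v x) = ip w u - ip w v"
  by (simp add: ip_def inner_diff_right integrable_inner)

lemma ip_scaleR_left: "ip (\<lambda>x. a *\<^sub>R u x) v = a * ip u v"
  by (simp add: ip_def)

lemma ip_scaleR_right: "ip u (\<lambda>x. a *\<^sub>R v x) = a * ip u v"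
  by (simp add: ip_def)

lemma ip_const_left: "u \<in> L2 Lx Ly \<Longrightarrow> ip (\<lambda>x. c) u = c \<bullet> (LINT x|M. u x)"
  by (simp add: ip_def L2_integrable)

lemma ip_cong_AE:
  assumes "u \<in> L2 Lx Ly" "u' \<in> L2 Lx Ly" "v \<in> L2 Lx Ly" "v' \<in> L2 Lx Ly"
    and "ae_eq Lx Ly u u'" "ae_eq Lx Ly v v'"
  shows "ip u v = ip u' v'"
  unfolding ip_def
proof (rule integral_cong_AE)
  note [measurable] = assms(1-4)[THEN L2_measurable_torus]
  show "(\<lambda>x. u x \<bullet> v x) \<in> borel_measurable M" "(\<lambda>x. u' x \<bullet> v' x) \<in> borel_measurable M"
    by simp_all
  show "AE x in M. u x \<bullet> v x = u' x \<bullet> v' x"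
    using assms(5,6) unfolding ae_eq_def by eventually_elim simp
qed

lemma ip_zero_AE_left: "ae_eq Lx Ly u (\<lambda>x. 0) \<Longrightarrow> ip u v = 0"
  unfolding ip_def ae_eq_def by (rule integral_eq_zero_AE) (auto elim: eventually_mono)

lemma L2norm_sq: "(L2norm Lx Ly u)\<^sup>2 = ip u u"
  by (simp add: L2norm_def ip_def power2_norm_eq_inner)

lemma L2norm_nonneg [simp]: "0 \<le> L2norm Lx Ly u"
  by (simp add: L2norm_def)

lemma ip_self_nonneg: "0 \<le> ip u u"
  by (simp add: ip_def)

lemma ip_self_eq_0D:
  assumes "u \<in> L2 Lx Ly" "ip u u = 0" shows "ae_eq Lx Ly u (\<lambda>x. 0)"
proof -
  have "AE x in M. u x \<bullet> u x = 0"
    using assms integral_nonneg_eq_0_iff_AE[OF integrable_inner[OF assms(1) assms(1)]]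
    by (simp add: ip_def)
  then show ?thesis by (simp add: ae_eq_def)
qed

text \<open>Elements are functions and not classes modulo null sets, so \<open>ip\<close> is only
  semidefinite and the case of a vanishing norm is treated separately.\<close>

lemma ip_Cauchy_Schwarz:
  assumes u: "u \<in> L2 Lx Ly" and v: "v \<in> L2 Lx Ly"
  shows "\<bar>ip u v\<bar> \<le> L2norm Lx Ly u * L2norm Lx Ly v"
proof -
  let ?a = "L2norm Lx Ly u" and ?b = "L2norm Lx Ly v"
  show ?thesis
  proof (cases "?a = 0 \<or> ?b = 0")
    case True
    then have "ae_eq Lx Ly u (\<lambda>x. 0) \<or> ae_eq Lx Ly v (\<lambda>x. 0)"
      using L2norm_sq[of u] L2norm_sq[of v] ip_self_eq_0D[OF u] ip_self_eq_0D[OF v] by auto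
    then have "ip u v = 0" using ip_zero_AE_left ip_commute by metis
    then show ?thesis by simp
  next
    case False
    then have ab: "0 < ?a * ?b" using L2norm_nonneg by (simp add: less_le)
    \<comment> \<open>This is the square of the norm of \<open>?b u + s ?a v\<close>. The two signs
      of \<open>s\<close> give the two halves of the absolute value.\<close>
    have sq: "0 \<le> 2 * (?a * ?b) * (?a * ?b + s * ip u v)" if s: "s = 1 \<or> s = -1" for s
    proof -
      let ?w = "\<lambda>x. ?b *\<^sub>R u x + (s * ?a) *\<^sub>R v x"
      have "ip ?w ?w = ?b\<^sup>2 * ip u u + 2 * s * ?a * ?b * ip u v + (s * ?a)\<^sup>2 * ip v v"
        using u v by (simp add: ip_add_left ip_add_right L2_add L2_scaleR ip_scaleR_left
          ip_scaleR_right ip_commute[of v u] power2_eq_square algebra_simps)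
      also have "\<dots> = 2 * (?a * ?b) * (?a * ?b + s * ip u v)"
        using s by (auto simp flip: L2norm_sq simp: power2_eq_square algebra_simps)
      finally show ?thesis using ip_self_nonneg[of ?w] by simp
    qed
    have pos: "0 \<le> y" if "0 \<le> x * y" "0 < x" for x y :: real
      using that by (simp add: zero_le_mult_iff)
    have "0 \<le> ?a * ?b + s * ip u v" if "s = 1 \<or> s = -1" for s
      by (rule pos[OF sq[OF that]]) (use ab in simp)
    from this[of 1] this[of "-1"] show ?thesis by (simp add: abs_le_iff)
  qed
qed

lemma L2norm_const: "L2norm Lx Ly (\<lambda>x. c) = sqrt area * norm c"
  by (simp add: L2norm_def real_sqrt_mult)

lemma L2norm_cong_AE:
  assumes "u \<in> L2 Lx Ly" "u' \<in> L2 Lx Ly" "ae_eq Lx Ly u u'"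
  shows "L2norm Lx Ly u = L2norm Lx Ly u'"
proof -
  have "(L2norm Lx Ly u)\<^sup>2 = (L2norm Lx Ly u')\<^sup>2"
    unfolding L2norm_sq using assms by (intro ip_cong_AE)
  then show ?thesis by simp
qed

section \<open>Trigonometric polynomials\<close>

text \<open>The phase lets one real family contain both sines and cosines: differentiation becomes a
  shift of the phase by \<open>pi / 2\<close>, up to the wave number as a factor.\<close>

definition mode :: "int \<Rightarrow> int \<Rightarrow> real \<Rightarrow> plane \<Rightarrow> real" where
  "mode m n \<theta> v = cos (2 * pi * of_int m / Lx * fst v + 2 * pi * of_int n / Ly * snd v + \<theta>)"

inductive_set trig :: "(plane \<Rightarrow> real) set" where
  trig_mode: "(\<lambda>v. a * mode m n \<theta> v) \<in> trig"
| trig_add: "p \<in> trig \<Longrightarrow> q \<in> trig \<Longrightarrow> (\<lambda>v. p v + q v) \<in> trig"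

lemma mode_zero: "mode 0 0 \<theta> v = cos \<theta>"
  by (simp add: mode_def)

lemma mode_mult:
  "mode m n \<theta> v * mode m' n' \<theta>' v
    = 1/2 * mode (m - m') (n - n') (\<theta> - \<theta>') v + 1/2 * mode (m + m') (n + n') (\<theta> + \<theta>') v"
proof -
  let ?A = "2 * pi * of_int m / Lx * fst v + 2 * pi * of_int n / Ly * snd v + \<theta>"
  let ?B = "2 * pi * of_int m' / Lx * fst v + 2 * pi * of_int n' / Ly * snd v + \<theta>'"
  have eq: "2 * pi * of_int (m - m') / Lx * fst v + 2 * pi * of_int (n - n') / Ly * snd v + (\<theta> - \<theta>') = ?A - ?B"
    "2 * pi * of_int (m + m') / Lx * fst v + 2 * pi * of_int (n + n') / Ly * snd v + (\<theta> + \<theta>') = ?A + ?B"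
    by (simp_all add: algebra_simps add_divide_distrib diff_divide_distrib)
  show ?thesis
    unfolding mode_def cos_times_cos[of ?A ?B] eq by simp
qed

lemma trig_const: "(\<lambda>v. c) \<in> trig"
  using trig_mode[of c 0 0 0] by (simp add: mode_zero)

lemma trig_cmult: "p \<in> trig \<Longrightarrow> (\<lambda>v. c * p v) \<in> trig"
proof (induction rule: trig.induct)
  case (trig_mode a m n \<theta>)
  then show ?case using trig.trig_mode[of "c * a" m n \<theta>] by (simp add: mult.assoc)
qed (simp add: trig.trig_add distrib_left)

lemma trig_mult:
  assumes "p \<in> trig" "q \<in> trig" shows "(\<lambda>v. p v * q v) \<in> trig"
  using assms
proof (induction rule: trig.induct)
  case (trig_mode a m n \<theta>)
  from trig_mode show ?case
  proof (induction rule: trig.induct)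
    case (trig_mode b m' n' \<theta>')
    have eq: "(\<lambda>v. a * mode m n \<theta> v * (b * mode m' n' \<theta>' v))
      = (\<lambda>v. (a * b) * (1/2 * mode (m - m') (n - n') (\<theta> - \<theta>') v
          + 1/2 * mode (m + m') (n + n') (\<theta> + \<theta>') v))"
      unfolding mode_mult[symmetric] by (simp add: mult_ac)
    show ?case unfolding eq
      by (intro trig_cmult trig.intros)
  qed (simp add: trig.trig_add distrib_left)
qed (simp add: trig.trig_add distrib_right)

text \<open>This transfers polynomial approximation in one real variable to functions on the
  torus.\<close>

lemma real_polynomial_function_comp_trig:
  fixes P :: "real \<Rightarrow> real"
  assumes "real_polynomial_function P" "q \<in> trig" shows "(\<lambda>v. P (q v)) \<in> trig"
  using assms(1)
proof (induction rule: real_polynomial_function.induct)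
  case (linear f)
  have "f x = f 1 * x" for x
    using linear_scale[OF bounded_linear.linear[OF linear], of x 1] by simp
  then have "(\<lambda>v. f (q v)) = (\<lambda>v. f 1 * q v)" by (intro ext)
  then show ?case using trig_cmult[OF assms(2), of "f 1"] by simp
qed (auto intro: trig_const trig_add trig_mult)

lemma periodic_trig: "p \<in> trig \<Longrightarrow> periodic Lx Ly p"
proof (induction rule: trig.induct)
  case (trig_mode a m n \<theta>)
  have "mode m n \<theta> (x + Lx, y) = mode m n \<theta> (x, y)" for x y
  proof -
    have "mode m n \<theta> (x + Lx, y)
        = cos ((2 * pi * of_int m / Lx * x + 2 * pi * of_int n / Ly * y + \<theta>) + 2 * pi * of_int m)"
      using Lx by (simp add: mode_def field_simps)
    then show ?thesis by (simp only: cos_add_2pi_int) (simp add: mode_def)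
  qed
  moreover have "mode m n \<theta> (x, y + Ly) = mode m n \<theta> (x, y)" for x y
  proof -
    have "mode m n \<theta> (x, y + Ly)
        = cos ((2 * pi * of_int m / Lx * x + 2 * pi * of_int n / Ly * y + \<theta>) + 2 * pi * of_int n)"
      using Ly by (simp add: mode_def field_simps)
    then show ?thesis by (simp only: cos_add_2pi_int) (simp add: mode_def)
  qed
  ultimately show ?case by (simp add: periodic_def)
qed (simp add: periodic_def)

lemma mode_has_derivative:
  "((\<lambda>v. a * mode m n \<theta> v) has_derivative (\<lambda>h.
      (2 * pi * of_int m / Lx * fst h + 2 * pi * of_int n / Ly * snd h)
        * (a * mode m n (\<theta> + pi / 2) v))) (at v)"
proof -
  have "cos (x + (\<theta> + pi / 2)) = - sin (x + \<theta>)" for x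
    using minus_sin_cos_eq[of "x + \<theta>"] by (simp add: add.assoc)
  then show ?thesis
    using Lx Ly unfolding mode_def by (auto intro!: derivative_eq_intros)
qed

lemma grad_mode:
  "grad (\<lambda>v. a * mode m n \<theta> v) v
    = (2 * pi * of_int m / Lx * a * mode m n (\<theta> + pi / 2) v,
       2 * pi * of_int n / Ly * a * mode m n (\<theta> + pi / 2) v)"
  unfolding grad_def frechet_derivative_at[OF mode_has_derivative, symmetric] by simp

lemma differentiable_trig: "p \<in> trig \<Longrightarrow> p differentiable (at v)"
proof (induction rule: trig.induct)
  case (trig_mode a m n \<theta>)
  show ?case using mode_has_derivative unfolding differentiable_def by blast
qed (rule differentiable_add)

lemma grad_trig:
  assumes "p \<in> trig"
  shows "(\<lambda>v. fst (grad p v)) \<in> trig" "(\<lambda>v. snd (grad p v)) \<in> trig"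
  using assms
proof (induction rule: trig.induct)
  case (trig_mode a m n \<theta>)
  { case 1 show ?case unfolding grad_mode fst_conv by (rule trig.trig_mode) }
  { case 2 show ?case unfolding grad_mode snd_conv by (rule trig.trig_mode) }
next
  case (trig_add p q)
  { case 1 show ?case using trig_add by (simp add: grad_add differentiable_trig trig.trig_add) }
  { case 2 show ?case using trig_add by (simp add: grad_add differentiable_trig trig.trig_add) }
qed

lemma continuous_trig: "p \<in> trig \<Longrightarrow> continuous_on UNIV p"
  using differentiable_trig by (simp add: continuous_at_imp_continuous_on differentiable_imp_continuous_within)

text \<open>The induction is over all \<open>p\<close> at once, since the partial derivatives are
  again trigonometric polynomials.\<close>

lemma Ck_trig: "p \<in> trig \<Longrightarrow> Ck n p"
  by (induction n arbitrary: p)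
    (auto simp: continuous_trig grad_trig differentiable_on_def differentiable_trig)

lemma test_function_trig: "p \<in> trig \<Longrightarrow> test_function Lx Ly p"
  by (simp add: test_function_def periodic_trig Ck_trig)

lemma trig_bounded: "p \<in> trig \<Longrightarrow> \<exists>B. \<forall>v. norm (p v) \<le> B"
proof (induction rule: trig.induct)
  case (trig_mode a m n \<theta>)
  have "norm (a * mode m n \<theta> v) \<le> \<bar>a\<bar>" for v
    by (simp add: mode_def abs_mult mult_left_le)
  then show ?case by blast
next
  case (trig_add p q)
  then obtain B C where "\<forall>v. norm (p v) \<le> B" "\<forall>v. norm (q v) \<le> C" by auto
  then have "norm (p v + q v) \<le> B + C" for v by (meson add_mono norm_triangle_le)
  then show ?case by blast
qed

lemma L2_trig: "p \<in> trig \<Longrightarrow> p \<in> L2 Lx Ly"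
  using trig_bounded[of p] L2_bounded[of p] periodic_trig[of p] continuous_trig[of p]
  by (auto simp: borel_measurable_continuous_onI)

lemma L2_Pair:
  assumes "p \<in> L2 Lx Ly" "q \<in> L2 Lx Ly" shows "(\<lambda>v. (p v :: real, q v :: real)) \<in> L2 Lx Ly"
proof -
  have "(\<lambda>v. (p v *\<^sub>R (1, 0) + q v *\<^sub>R (0, 1) :: plane)) \<in> L2 Lx Ly"
    by (intro L2_add L2_bounded_linear[OF bounded_linear_scaleR_left] assms)
  then show ?thesis by simp
qed

lemma L2_grad_trig: "p \<in> trig \<Longrightarrow> grad p \<in> L2 Lx Ly"
  using L2_Pair[OF L2_trig[OF grad_trig(1)] L2_trig[OF grad_trig(2)], of p p] by simp

text \<open>Both orders of integration are provided because a nonconstant mode may oscillate in one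
  coordinate only, and that coordinate has to be the inner one.\<close>

lemma LINT_torus:
  fixes f :: "plane \<Rightarrow> real"
  assumes "integrable M f"
  shows "(LINT v|M. f v)
      = (LINT x|lborel. LINT y|lborel. indicator {0..<Lx} x * (indicator {0..<Ly} y * f (x, y)))"
    "(LINT v|M. f v)
      = (LINT y|lborel. LINT x|lborel. indicator {0..<Ly} y * (indicator {0..<Lx} x * f (x, y)))"
proof -
  let ?F = "\<lambda>v. indicator ({0..<Lx} \<times> {0..<Ly}) v *\<^sub>R f v"
  have F: "(\<lambda>(x, y). ?F (x, y)) = ?F"
    by auto
  have int: "integrable (lborel \<Otimes>\<^sub>M lborel) (\<lambda>(x, y). ?F (x, y))"
    using assms unfolding torus_def F lborel_prod
    by (subst (asm) integrable_restrict_space) (simp_all add: sets_cell)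
  have eq: "(LINT v|M. f v) = integral\<^sup>L (lborel \<Otimes>\<^sub>M lborel) (\<lambda>(x, y). ?F (x, y))"
    unfolding torus_def F lborel_prod
    by (subst integral_restrict_space) (simp_all add: sets_cell)
  show "(LINT v|M. f v)
      = (LINT x|lborel. LINT y|lborel. indicator {0..<Lx} x * (indicator {0..<Ly} y * f (x, y)))"
    unfolding eq lborel_pair.integral_fst[OF int, symmetric] by (simp add: indicator_times mult.assoc)
  show "(LINT v|M. f v)
      = (LINT y|lborel. LINT x|lborel. indicator {0..<Ly} y * (indicator {0..<Lx} x * f (x, y)))"
    unfolding eq lborel_pair.integral_snd[OF int, symmetric] by (simp add: indicator_times mult_ac)
qed

lemma LINT_mode:
  assumes "m \<noteq> 0 \<or> n \<noteq> 0" shows "(LINT v|M. mode m n \<theta> v) = 0"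
proof -
  have int: "integrable M (mode m n \<theta>)"
    using L2_integrable[OF L2_trig[OF trig_mode[of 1 m n \<theta>]]] by simp
  from assms show ?thesis
  proof
    assume "m \<noteq> 0"
    have "(LINT x|lborel. indicator {0..<Lx} x * mode m n \<theta> (x, y)) = 0" for y
      using LINT_cos_period[OF Lx \<open>m \<noteq> 0\<close>, of "2 * pi * of_int n / Ly * y + \<theta>"]
      by (simp add: mode_def add.assoc)
    then show ?thesis unfolding LINT_torus(2)[OF int] by simp
  next
    assume "n \<noteq> 0"
    have "(LINT y|lborel. indicator {0..<Ly} y * mode m n \<theta> (x, y)) = 0" for x
      using LINT_cos_period[OF Ly \<open>n \<noteq> 0\<close>, of "2 * pi * of_int m / Lx * x + \<theta>"]
      by (simp add: mode_def add_ac)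
    then show ?thesis unfolding LINT_torus(1)[OF int] by simp
  qed
qed

text \<open>The periodic divergence theorem, read off mode by mode: the constant mode has zero
  gradient, and every other mode has zero integral.\<close>

lemma LINT_grad_trig: "p \<in> trig \<Longrightarrow> (LINT v|M. grad p v) = 0"
proof (induction rule: trig.induct)
  case (trig_mode a m n \<theta>)
  have "grad (\<lambda>v. a * mode m n \<theta> v)
      = (\<lambda>v. mode m n (\<theta> + pi / 2) v *\<^sub>R (2 * pi * of_int m / Lx * a, 2 * pi * of_int n / Ly * a))"
    by (simp add: grad_mode fun_eq_iff mult_ac)
  moreover have "integrable M (mode m n (\<theta> + pi / 2))"
    using L2_integrable[OF L2_trig[OF trig.trig_mode[of 1 m n "\<theta> + pi / 2"]]] by simp
  ultimately show ?case
    using LINT_mode[of m n "\<theta> + pi / 2"]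
    by (cases "m = 0 \<and> n = 0") (auto simp only: integral_scaleR_left, auto simp: zero_prod_def)
next
  case (trig_add p q)
  then have "grad (\<lambda>v. p v + q v) = (\<lambda>v. grad p v + grad q v)"
    by (auto simp: grad_add differentiable_trig)
  with trig_add show ?case
    by (simp add: L2_integrable L2_grad_trig)
qed

lemma grad_mixed_trig:
  "p \<in> trig \<Longrightarrow> snd (grad (\<lambda>v. fst (grad p v)) v) = fst (grad (\<lambda>v. snd (grad p v)) v)"
proof (induction rule: trig.induct)
  case (trig_mode a m n \<theta>)
  show ?case unfolding grad_mode fst_conv snd_conv by (simp add: mult_ac)
next
  case (trig_add p q)
  then show ?case by (simp add: grad_add differentiable_trig grad_trig)
qed

text \<open>The integrand is the Jacobian of \<open>p\<close> and \<open>q\<close>. By equality of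
  mixed derivatives it is the divergence of \<open>p\<close> times the field with components
  \<open>q_y\<close> and \<open>-q_x\<close>, so it integrates to zero over a period cell.\<close>

lemma ip_perp_grad_grad:
  assumes p: "p \<in> trig" and q: "q \<in> trig"
  shows "ip (\<lambda>v. perp (grad p v)) (grad q) = 0"
proof -
  let ?q1 = "\<lambda>v. fst (grad q v)" and ?q2 = "\<lambda>v. snd (grad q v)"
  note [simp] = grad_trig[OF q] differentiable_trig p q
  have pq: "(\<lambda>v. p v * ?q1 v) \<in> trig" "(\<lambda>v. p v * ?q2 v) \<in> trig"
    by (intro trig_mult; simp)+
  have "perp (grad p v) \<bullet> grad q v
      = fst (grad (\<lambda>v. p v * ?q2 v) v) - snd (grad (\<lambda>v. p v * ?q1 v) v)" for v
    using grad_mixed_trig[OF q, of v]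
    by (simp add: grad_mult perp_def inner_prod_def algebra_simps)
  then have "ip (\<lambda>v. perp (grad p v)) (grad q)
      = (LINT v|M. fst (grad (\<lambda>v. p v * ?q2 v) v)) - (LINT v|M. snd (grad (\<lambda>v. p v * ?q1 v) v))"
    unfolding ip_def by (simp add: L2_integrable L2_trig grad_trig pq)
  also have "\<dots> = 0"
    using pq[THEN LINT_grad_trig] pq[THEN L2_grad_trig, THEN L2_integrable]
    by (simp add: integral_bounded_linear[OF bounded_linear_fst]
      integral_bounded_linear[OF bounded_linear_snd])
  finally show ?thesis .
qed

section \<open>Density of trigonometric polynomials\<close>

text \<open>Periodicity, which is built into \<open>L2\<close>, is dropped: indicators of quadrants
  and of general Borel sets are not periodic, and only their values on the cell matter for the
  approximation.\<close>

definition sq_integrable :: "(plane \<Rightarrow> real) \<Rightarrow> bool" where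
  "sq_integrable f \<longleftrightarrow> f \<in> borel_measurable M \<and> integrable M (\<lambda>x. (f x)\<^sup>2)"

definition trig_approx :: "(plane \<Rightarrow> real) \<Rightarrow> bool" where
  "trig_approx f \<longleftrightarrow> sq_integrable f \<and> (\<forall>e>0. \<exists>p\<in>trig. (LINT x|M. (f x - p x)\<^sup>2) < e)"

lemma sq_integrable_bound:
  assumes "sq_integrable w" "f \<in> borel_measurable M" "\<And>x. x \<in> space M \<Longrightarrow> \<bar>f x\<bar> \<le> \<bar>w x\<bar>"
  shows "sq_integrable f"
proof -
  note [measurable] = assms(2)
  have "integrable M (\<lambda>x. (f x)\<^sup>2)"
  proof (rule Bochner_Integration.integrable_bound)
    show "integrable M (\<lambda>x. (w x)\<^sup>2)" using assms(1) by (simp add: sq_integrable_def)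
    show "(\<lambda>x. (f x)\<^sup>2) \<in> borel_measurable M" by simp
    have "(f x)\<^sup>2 \<le> (w x)\<^sup>2" if "x \<in> space M" for x
      using assms(3)[OF that] by (simp only: abs_le_square_iff)
    then show "AE x in M. norm ((f x)\<^sup>2) \<le> norm ((w x)\<^sup>2)" by (intro AE_I2) simp
  qed
  then show ?thesis using assms by (simp add: sq_integrable_def)
qed

lemma sq_integrable_add:
  assumes "sq_integrable f" "sq_integrable g" shows "sq_integrable (\<lambda>x. f x + g x)"
proof -
  have [measurable]: "f \<in> borel_measurable M" "g \<in> borel_measurable M"
    using assms by (simp_all add: sq_integrable_def)
  have "integrable M (\<lambda>x. (f x + g x)\<^sup>2)"
  proof (rule Bochner_Integration.integrable_bound)
    show "integrable M (\<lambda>x. 2 * (f x)\<^sup>2 + 2 * (g x)\<^sup>2)"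
      using assms by (simp add: sq_integrable_def)
    show "(\<lambda>x. (f x + g x)\<^sup>2) \<in> borel_measurable M" by simp
    show "AE x in M. norm ((f x + g x)\<^sup>2) \<le> norm (2 * (f x)\<^sup>2 + 2 * (g x)\<^sup>2)"
      using real_sq_add_le by (intro AE_I2) simp
  qed
  then show ?thesis by (simp add: sq_integrable_def)
qed

lemma sq_integrable_cmult: "sq_integrable f \<Longrightarrow> sq_integrable (\<lambda>x. c * f x)"
  by (auto simp: sq_integrable_def power_mult_distrib)

lemma sq_integrable_diff:
  assumes "sq_integrable f" "sq_integrable g" shows "sq_integrable (\<lambda>x. f x - g x)"
  using sq_integrable_add[OF assms(1) sq_integrable_cmult[OF assms(2), of "-1"]] by simp

lemma sq_integrable_L2: "f \<in> L2 Lx Ly \<Longrightarrow> sq_integrable f"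
  using L2_square_integrable[of f] by (simp add: sq_integrable_def L2_measurable_torus)

lemma LINT_sq_add_le:
  assumes "sq_integrable f" "sq_integrable g"
  shows "(LINT x|M. (f x + g x)\<^sup>2) \<le> 2 * (LINT x|M. (f x)\<^sup>2) + 2 * (LINT x|M. (g x)\<^sup>2)"
proof -
  have "(LINT x|M. (f x + g x)\<^sup>2) \<le> (LINT x|M. 2 * (f x)\<^sup>2 + 2 * (g x)\<^sup>2)"
    using assms sq_integrable_add[OF assms]
    by (intro integral_mono) (auto simp: sq_integrable_def real_sq_add_le)
  also have "\<dots> = 2 * (LINT x|M. (f x)\<^sup>2) + 2 * (LINT x|M. (g x)\<^sup>2)"
    using assms by (simp add: sq_integrable_def)
  finally show ?thesis .
qed

lemma trig_approx_close:
  assumes f: "sq_integrable f"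
    and g: "\<And>e. 0 < e \<Longrightarrow> \<exists>g. trig_approx g \<and> (LINT x|M. (f x - g x)\<^sup>2) < e"
  shows "trig_approx f"
  unfolding trig_approx_def
proof (intro conjI allI impI f)
  fix e :: real assume "0 < e"
  \<comment> \<open>Each error is doubled by \<open>LINT_sq_add_le\<close>, so two errors below
    \<open>e / 4\<close> add up to less than \<open>e\<close>.\<close>
  then obtain g where g: "trig_approx g" "(LINT x|M. (f x - g x)\<^sup>2) < e / 4"
    using g[of "e / 4"] by auto
  then obtain p where p: "p \<in> trig" "(LINT x|M. (g x - p x)\<^sup>2) < e / 4"
    using \<open>0 < e\<close> unfolding trig_approx_def by (meson divide_pos_pos zero_less_numeral)
  have "(LINT x|M. ((f x - g x) + (g x - p x))\<^sup>2)
      \<le> 2 * (LINT x|M. (f x - g x)\<^sup>2) + 2 * (LINT x|M. (g x - p x)\<^sup>2)"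
    using f g(1) sq_integrable_L2[OF L2_trig[OF p(1)]]
    by (intro LINT_sq_add_le sq_integrable_diff) (auto simp: trig_approx_def)
  with g p show "\<exists>p\<in>trig. (LINT x|M. (f x - p x)\<^sup>2) < e"
    by (intro bexI[of _ p]) auto
qed

text \<open>The one limiting principle of the density proof. It carries the approximation from
  polynomials to indicators of quadrants, through countable disjoint unions, and from simple
  functions to arbitrary ones.\<close>

lemma trig_approx_dominated_limit:
  assumes g: "\<And>n. trig_approx (g n)"
    and lim: "\<And>x. x \<in> space M \<Longrightarrow> (\<lambda>n. g n x) \<longlonglongrightarrow> f x"
    and bound: "\<And>n x. x \<in> space M \<Longrightarrow> \<bar>g n x\<bar> \<le> w x"
    and w: "sq_integrable w" and f: "f \<in> borel_measurable M"
  shows "trig_approx f"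
proof -
  have g': "sq_integrable (g n)" for n using g by (simp add: trig_approx_def)
  note [measurable] = f
  have [measurable]: "g n \<in> borel_measurable M" for n
    using g' by (simp add: sq_integrable_def)
  have fw: "\<bar>f x\<bar> \<le> w x" if x: "x \<in> space M" for x
    by (rule LIMSEQ_le_const2[OF tendsto_rabs[OF lim[OF x]]]) (use bound[OF x] in auto)
  have fi: "sq_integrable f"
    using fw by (intro sq_integrable_bound[OF w f]) force
  have "(\<lambda>n. LINT x|M. (f x - g n x)\<^sup>2) \<longlonglongrightarrow> (LINT x|M. 0)"
  \<comment> \<open>Both \<open>f\<close> and \<open>g n\<close> are bounded by \<open>w\<close>, so
    their difference is at most \<open>2 * w\<close>; squaring gives the factor 4.\<close>
  proof (rule integral_dominated_convergence[where w = "\<lambda>x. 4 * (w x)\<^sup>2"])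
    show "integrable M (\<lambda>x. 4 * (w x)\<^sup>2)" using w by (simp add: sq_integrable_def)
    have "(\<lambda>n. (f x - g n x)\<^sup>2) \<longlonglongrightarrow> 0" if x: "x \<in> space M" for x
      using tendsto_power[OF tendsto_diff[OF tendsto_const[of "f x"] lim[OF x]], of 2] by simp
    then show "AE x in M. (\<lambda>n. (f x - g n x)\<^sup>2) \<longlonglongrightarrow> 0" by (rule AE_I2)
    have "norm ((f x - g n x)\<^sup>2) \<le> 4 * (w x)\<^sup>2" if x: "x \<in> space M" for n x
    proof -
      have "\<bar>f x - g n x\<bar> \<le> \<bar>2 * w x\<bar>" using fw[OF x] bound[OF x, of n] by linarith
      then have "(f x - g n x)\<^sup>2 \<le> (2 * w x)\<^sup>2" by (simp only: abs_le_square_iff)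
      then show ?thesis by (simp add: power_mult_distrib)
    qed
    then show "AE x in M. norm ((f x - g n x)\<^sup>2) \<le> 4 * (w x)\<^sup>2" for n by (intro AE_I2)
  qed simp_all
  then have lim0: "(\<lambda>n. LINT x|M. (f x - g n x)\<^sup>2) \<longlonglongrightarrow> 0" by simp
  show ?thesis
  proof (rule trig_approx_close[OF fi])
    fix e :: real assume "0 < e"
    then obtain n where "(LINT x|M. (f x - g n x)\<^sup>2) < e"
      using order_tendstoD(2)[OF lim0] by (auto simp: eventually_sequentially)
    then show "\<exists>g. trig_approx g \<and> (LINT x|M. (f x - g x)\<^sup>2) < e" using g by blast
  qed
qed

lemma trig_approx_trig: "p \<in> trig \<Longrightarrow> trig_approx p"
  unfolding trig_approx_def using sq_integrable_L2[OF L2_trig] by (auto intro!: bexI[of _ p])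

lemma trig_approx_add:
  assumes "trig_approx f" "trig_approx g" shows "trig_approx (\<lambda>x. f x + g x)"
  unfolding trig_approx_def
proof (intro conjI allI impI)
  have fg: "sq_integrable f" "sq_integrable g" using assms by (auto simp: trig_approx_def)
  then show "sq_integrable (\<lambda>x. f x + g x)" by (rule sq_integrable_add)
  fix e :: real assume "0 < e"
  then obtain p q where p: "p \<in> trig" "(LINT x|M. (f x - p x)\<^sup>2) < e / 4"
    and q: "q \<in> trig" "(LINT x|M. (g x - q x)\<^sup>2) < e / 4"
    using assms unfolding trig_approx_def by (meson divide_pos_pos zero_less_numeral)
  have "(LINT x|M. ((f x - p x) + (g x - q x))\<^sup>2)
      \<le> 2 * (LINT x|M. (f x - p x)\<^sup>2) + 2 * (LINT x|M. (g x - q x)\<^sup>2)"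
    using fg sq_integrable_L2[OF L2_trig[OF p(1)]] sq_integrable_L2[OF L2_trig[OF q(1)]]
    by (intro LINT_sq_add_le sq_integrable_diff)
  also have "(\<lambda>x. ((f x - p x) + (g x - q x))\<^sup>2) = (\<lambda>x. (f x + g x - (p x + q x))\<^sup>2)"
    by (simp add: algebra_simps)
  finally show "\<exists>p\<in>trig. (LINT x|M. (f x + g x - p x)\<^sup>2) < e"
    using p q by (intro bexI[of _ "\<lambda>x. p x + q x"] trig_add) auto
qed

lemma trig_approx_cmult:
  assumes "trig_approx f" shows "trig_approx (\<lambda>x. c * f x)"
  unfolding trig_approx_def
proof (intro conjI allI impI)
  show "sq_integrable (\<lambda>x. c * f x)"
    using assms sq_integrable_cmult by (simp add: trig_approx_def)
  fix e :: real assume "0 < e"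
  \<comment> \<open>Adding 1 keeps the denominator positive when \<open>c = 0\<close>.\<close>
  then have "0 < e / (c\<^sup>2 + 1)" by (simp add: add_nonneg_pos)
  then obtain p where p: "p \<in> trig" "(LINT x|M. (f x - p x)\<^sup>2) < e / (c\<^sup>2 + 1)"
    using assms unfolding trig_approx_def by blast
  have "(LINT x|M. (c * f x - c * p x)\<^sup>2) = c\<^sup>2 * (LINT x|M. (f x - p x)\<^sup>2)"
    by (simp flip: right_diff_distrib add: power_mult_distrib)
  also have "\<dots> \<le> (c\<^sup>2 + 1) * (LINT x|M. (f x - p x)\<^sup>2)"
    by (intro mult_right_mono) auto
  also have "\<dots> < e"
    using p(2) by (simp add: pos_less_divide_eq add_nonneg_pos mult.commute)
  finally show "\<exists>p\<in>trig. (LINT x|M. (c * f x - p x)\<^sup>2) < e"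
    using p(1) by (intro bexI[of _ "\<lambda>x. c * p x"] trig_cmult)
qed

lemma trig_approx_sum:
  "finite I \<Longrightarrow> (\<And>i. i \<in> I \<Longrightarrow> trig_approx (f i)) \<Longrightarrow> trig_approx (\<lambda>x. \<Sum>i\<in>I. f i x)"
  by (induction rule: finite_induct)
     (auto intro: trig_approx_add trig_approx_trig[OF trig_const])

text \<open>A superlevel set of \<open>q\<close> is reached by composing \<open>q\<close> with
  polynomials in one variable that approximate a step function. The uniform bound 2 makes the limit
  a dominated one.\<close>

lemma trig_threshold:
  assumes q: "q \<in> trig" and q1: "\<And>v. \<bar>q v\<bar> \<le> 1"
  obtains P where "\<And>n. P n \<in> trig" "\<And>n v. \<bar>P n v\<bar> \<le> 2"
    "\<And>v. (\<lambda>n. P n v) \<longlonglongrightarrow> indicator {v. \<kappa> \<le> q v} v"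
proof -
  \<comment> \<open>A continuous ramp equal to 1 on \<open>s \<ge> \<kappa>\<close> and descending
    to the left of \<open>\<kappa>\<close> with slope \<open>n\<close> until it reaches 0. Its limit
    is the step function, closed at \<open>\<kappa>\<close>.\<close>
  define g where "g n s = max 0 (1 - real n * max 0 (\<kappa> - s))" for n s
  have g01: "0 \<le> g n s" "g n s \<le> 1" for n s
    by (auto simp: g_def mult_nonneg_nonneg)
  have "\<exists>R. real_polynomial_function R \<and> (\<forall>s\<in>{-1..1}. \<bar>g n s - R s\<bar> < 1 / Suc n)" for n
  proof -
    \<comment> \<open>Weierstrass approximation on the range of \<open>q\<close>. The error
      \<open>1 / Suc n\<close> vanishes in the limit and is at most 1, so the polynomials stay below
      1 + 1 = 2 there.\<close>
    have "continuous_on {-1..1} (g n)"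
      unfolding g_def by (intro continuous_intros)
    then show ?thesis
      using Stone_Weierstrass_real_polynomial_function[of "{-1..1}" "g n" "1 / Suc n"]
      by (metis compact_Icc of_nat_0_less_iff zero_less_Suc zero_less_divide_1_iff)
  qed
  then obtain R where R: "\<And>n. real_polynomial_function (R n)"
    "\<And>n s. s \<in> {-1..1} \<Longrightarrow> \<bar>g n s - R n s\<bar> < 1 / Suc n"
    by metis
  have q1': "q v \<in> {-1..1}" for v using q1[of v] by (auto simp: abs_le_iff)
  show ?thesis
  proof
    show "(\<lambda>v. R n (q v)) \<in> trig" for n
      by (rule real_polynomial_function_comp_trig[OF R(1) q])
    show "\<bar>R n (q v)\<bar> \<le> 2" for n v
    proof -
      have "\<bar>g n (q v) - R n (q v)\<bar> < 1 / Suc n" by (rule R(2)[OF q1'])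
      also have "\<dots> \<le> 1" by simp
      finally show ?thesis using g01[of n "q v"] by linarith
    qed
    show "(\<lambda>n. R n (q v)) \<longlonglongrightarrow> indicator {v. \<kappa> \<le> q v} v" for v
    proof -
      have "(\<lambda>n. g n (q v)) \<longlonglongrightarrow> indicator {v. \<kappa> \<le> q v} v"
      proof (cases "\<kappa> \<le> q v")
        case True
        then show ?thesis by (simp add: g_def max_def)
      next
        case False
        then have pos: "0 < \<kappa> - q v" by simp
        obtain N where N: "1 < real N * (\<kappa> - q v)"
          using reals_Archimedean3[OF pos] by blast
        have "g n (q v) = 0" if "N \<le> n" for n
        proof -
          have "real N * (\<kappa> - q v) \<le> real n * (\<kappa> - q v)"
            using that pos by (intro mult_right_mono) auto
          then have "1 < real n * (\<kappa> - q v)" using N by linarith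
          then show ?thesis using pos by (simp add: g_def max_def)
        qed
        then have "\<forall>\<^sub>F n in sequentially. 0 = g n (q v)"
          by (auto simp: eventually_sequentially)
        then have "(\<lambda>n. g n (q v)) \<longlonglongrightarrow> 0"
          by (rule Lim_transform_eventually[OF tendsto_const])
        then show ?thesis using False by simp
      qed
      moreover have "(\<lambda>n. g n (q v) - R n (q v)) \<longlonglongrightarrow> 0"
      proof (rule Lim_null_comparison)
        have "norm (g n (q v) - R n (q v)) \<le> 1 / Suc n" for n
          unfolding real_norm_def by (rule less_imp_le[OF R(2)[OF q1']])
        then show "\<forall>\<^sub>F n in sequentially. norm (g n (q v) - R n (q v)) \<le> 1 / Suc n"
          by (intro always_eventually allI)
        show "(\<lambda>n. 1 / real (Suc n)) \<longlonglongrightarrow> 0"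
          using LIMSEQ_inverse_real_of_nat by (simp add: inverse_eq_divide)
      qed
      ultimately show ?thesis
        using tendsto_diff[of "\<lambda>n. g n (q v)" "indicator {v. \<kappa> \<le> q v} v" sequentially
          "\<lambda>n. g n (q v) - R n (q v)" 0] by simp
    qed
  qed
qed

lemma trig_halfplanes:
  obtains P Q where "\<And>n. P n \<in> trig" "\<And>n. Q n \<in> trig" "\<And>n v. \<bar>P n v\<bar> \<le> 2" "\<And>n v. \<bar>Q n v\<bar> \<le> 2"
    "\<And>v. v \<in> space M \<Longrightarrow> (\<lambda>n. P n v) \<longlonglongrightarrow> indicator {..a} (fst v)"
    "\<And>v. v \<in> space M \<Longrightarrow> (\<lambda>n. Q n v) \<longlonglongrightarrow> indicator {..b} (snd v)"
proof -
  \<comment> \<open>Both coordinates are handled at once: \<open>\<pi>\<close> stands for a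
    projection and \<open>L\<close> for the corresponding period.\<close>
  have seg: "\<exists>P. (\<forall>n. P n \<in> trig) \<and> (\<forall>n v. \<bar>P n v\<bar> \<le> 2) \<and>
      (\<forall>v\<in>space M. (\<lambda>n. P n v) \<longlonglongrightarrow> (indicator {..c} (\<pi> v) :: real))"
    if rng: "\<And>v. v \<in> space M \<Longrightarrow> 0 \<le> \<pi> v \<and> \<pi> v < L"
      and q: "\<And>s. (\<lambda>v. cos (2 * pi / L * \<pi> v - s)) \<in> trig" for L c and \<pi> :: "plane \<Rightarrow> real"
  proof -
    \<comment> \<open>In the first two cases the half-plane misses or contains the cell, and a
      constant sequence suffices. Only a threshold inside the cell needs the cosine.\<close>
    consider "c < 0" | "L \<le> c" | "0 \<le> c" "c < L" by linarith
    then show ?thesis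
    proof cases
      case 1
      then have "indicator {..c} (\<pi> v) = (0::real)" if "v \<in> space M" for v
        using rng[OF that] by auto
      then show ?thesis
        using trig_const[of 0] by (intro exI[of _ "\<lambda>n v. 0"]) auto
    next
      case 2
      then have "indicator {..c} (\<pi> v) = (1::real)" if "v \<in> space M" for v
        using rng[OF that] by auto
      then show ?thesis
        using trig_const[of 1] by (intro exI[of _ "\<lambda>n v. 1"]) auto
    next
      case 3
      let ?q = "\<lambda>v. cos (2 * pi / L * \<pi> v - pi * c / L)"
      obtain P where P: "\<And>n. P n \<in> trig" "\<And>n v. \<bar>P n v\<bar> \<le> 2"
        "\<And>v. (\<lambda>n. P n v) \<longlonglongrightarrow> indicator {v. cos (pi * c / L) \<le> ?q v} v"
        using trig_threshold[OF q, of "pi * c / L" "cos (pi * c / L)"] by auto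
      have "(indicator {v. cos (pi * c / L) \<le> ?q v} v :: real) = indicator {..c} (\<pi> v)"
        if "v \<in> space M" for v
        using initial_segment_iff_cos[of c L "\<pi> v"] 3 rng[OF that] by (simp add: indicator_def)
      with P show ?thesis by (intro exI[of _ P]) metis
    qed
  qed
  have "\<exists>P. (\<forall>n. P n \<in> trig) \<and> (\<forall>n v. \<bar>P n v\<bar> \<le> 2) \<and>
      (\<forall>v\<in>space M. (\<lambda>n. P n v) \<longlonglongrightarrow> (indicator {..a} (fst v) :: real))"
    by (rule seg[of fst Lx])
       (use trig_mode[of 1 1 0] in \<open>auto simp: space_torus mode_def diff_conv_add_uminus simp del: add_uminus_conv_diff\<close>)
  moreover have "\<exists>P. (\<forall>n. P n \<in> trig) \<and> (\<forall>n v. \<bar>P n v\<bar> \<le> 2) \<and>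
      (\<forall>v\<in>space M. (\<lambda>n. P n v) \<longlonglongrightarrow> (indicator {..b} (snd v) :: real))"
    by (rule seg[of snd Ly])
       (use trig_mode[of 1 0 1] in \<open>auto simp: space_torus mode_def diff_conv_add_uminus simp del: add_uminus_conv_diff\<close>)
  ultimately show ?thesis using that by blast
qed

lemma sq_integrable_const: "sq_integrable (\<lambda>x. c)"
  by (simp add: sq_integrable_def)

text \<open>Dynkin's theorem applied to the closed quadrants, which generate the Borel sets and are
  stable under intersection.\<close>

lemma trig_approx_indicator:
  assumes "A \<in> sets borel" shows "trig_approx (indicator A)"
proof -
  let ?G = "range (\<lambda>a::plane. {..a})"
  have borel: "sets borel = sigma_sets UNIV ?G"
    by (subst borel_eq_atMost) simp
  have meas: "(indicator B :: plane \<Rightarrow> real) \<in> borel_measurable M" if "B \<in> sigma_sets UNIV ?G" for B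
    using that by (intro borel_measurable_torus borel_measurable_indicator) (simp add: borel)
  \<comment> \<open>The order on the plane is componentwise, so \<open>{..a}\<close> is a quadrant
    and the infimum is taken in each coordinate.\<close>
  have "{..a} \<inter> {..b} = {..inf a b}" for a b :: plane
    by auto
  then have "Int_stable ?G"
    unfolding Int_stable_def by blast
  moreover have "?G \<subseteq> Pow UNIV" "A \<in> sigma_sets UNIV ?G"
    using assms borel by auto
  ultimately show ?thesis
  proof (induction rule: sigma_sets_induct_disjoint)
    case (basic A)
    then obtain a b where A: "A = {..(a, b)}" by auto
    obtain P Q where PQ: "\<And>n. P n \<in> trig" "\<And>n. Q n \<in> trig" "\<And>n v. \<bar>P n v\<bar> \<le> 2" "\<And>n v. \<bar>Q n v\<bar> \<le> 2"
      "\<And>v. v \<in> space M \<Longrightarrow> (\<lambda>n. P n v) \<longlonglongrightarrow> indicator {..a} (fst v)"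
      "\<And>v. v \<in> space M \<Longrightarrow> (\<lambda>n. Q n v) \<longlonglongrightarrow> indicator {..b} (snd v)"
      by (rule trig_halfplanes) blast
    show ?case
    proof (rule trig_approx_dominated_limit)
      \<comment> \<open>A quadrant is the intersection of two half-planes, so its indicator is a
        product; the bound 4 used below is 2 times 2.\<close>
      show "trig_approx (\<lambda>v. P n v * Q n v)" for n
        using PQ by (intro trig_approx_trig trig_mult)
      show "(\<lambda>n. P n v * Q n v) \<longlonglongrightarrow> indicator A v" if "v \<in> space M" for v
        using tendsto_mult[OF PQ(5,6)[OF that]]
        by (cases v) (auto simp: A indicator_def less_eq_prod_def split: if_splits)
      show "\<bar>P n v * Q n v\<bar> \<le> 4" for n v
        using mult_mono[OF PQ(3)[of n v] PQ(4)[of n v]] by (simp add: abs_mult)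
      show "(indicator A :: plane \<Rightarrow> real) \<in> borel_measurable M"
        using basic by (intro meas) auto
    qed (rule sq_integrable_const)
  next
    case empty
    show ?case using trig_approx_trig[OF trig_const[of 0]] by simp
  next
    case (compl A)
    have "(indicator (UNIV - A) :: plane \<Rightarrow> real) = (\<lambda>v. 1 + (-1) * indicator A v)"
      by (auto simp: indicator_def fun_eq_iff)
    then show ?case
      using trig_approx_add[OF trig_approx_trig[OF trig_const[of 1]] trig_approx_cmult[OF compl(2), of "-1"]]
      by simp
  next
    case (union A)
    show ?case
    proof (rule trig_approx_dominated_limit)
      show "trig_approx (\<lambda>v. \<Sum>i<n. indicator (A i) v)" for n
        using union by (intro trig_approx_sum) auto
      \<comment> \<open>By disjointness the partial sums are themselves indicators, hence bounded by
        1 uniformly in \<open>n\<close>.\<close>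
      have eq: "(\<Sum>i<n. indicator (A i) v) = (indicator (\<Union>i<n. A i) v :: real)" for n v
        using union(1) by (subst indicator_UN_disjoint) (auto simp: disjoint_family_on_def)
      show "(\<lambda>n. \<Sum>i<n. indicator (A i) v) \<longlonglongrightarrow> (indicator (\<Union>i. A i) v :: real)" for v
        unfolding eq by (rule LIMSEQ_indicator_UN)
      show "\<bar>\<Sum>i<n. indicator (A i) v\<bar> \<le> (1::real)" for n v
        unfolding eq by (simp add: indicator_def)
      show "(indicator (\<Union>i. A i) :: plane \<Rightarrow> real) \<in> borel_measurable M"
        using union(2) by (intro meas sigma_sets.Union) auto
    qed (rule sq_integrable_const)
  qed
qed

lemma trig_approx_L2:
  assumes f: "f \<in> L2 Lx Ly" shows "trig_approx f"
proof -
  obtain F where F: "\<And>i. simple_function borel (F i)" "\<And>x. (\<lambda>i. F i x) \<longlonglongrightarrow> f x"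
    "\<And>i x. \<bar>F i x\<bar> \<le> 2 * \<bar>f x\<bar>"
    using borel_measurable_implies_sequence_metric[OF L2_measurable[OF f], of 0] by auto
  show ?thesis
  proof (rule trig_approx_dominated_limit[OF _ F(2,3)])
    fix i
    have "F i = (\<lambda>v. \<Sum>y\<in>range (F i). y * indicator (F i -` {y}) v)"
    proof
      fix v
      have "(\<Sum>y\<in>range (F i). y * indicator (F i -` {y}) v) = (\<Sum>y\<in>range (F i). if y = F i v then y else 0)"
        by (intro sum.cong) (auto simp: indicator_def)
      also have "\<dots> = F i v"
        using simple_functionD(1)[OF F(1)[of i]] by (subst sum.delta) auto
      finally show "F i v = (\<Sum>y\<in>range (F i). y * indicator (F i -` {y}) v)" by simp
    qed
    moreover have "trig_approx (\<lambda>v. \<Sum>y\<in>range (F i). y * indicator (F i -` {y}) v)"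
      using simple_functionD[OF F(1)[of i]]
      by (intro trig_approx_sum trig_approx_cmult trig_approx_indicator) auto
    ultimately show "trig_approx (F i)" by simp
  next
    show "sq_integrable (\<lambda>x. 2 * \<bar>f x\<bar>)"
      using sq_integrable_L2[OF f] by (auto simp: sq_integrable_def power_mult_distrib)
    show "f \<in> borel_measurable M" by (rule L2_measurable_torus[OF f])
  qed
qed

lemma trig_dense:
  assumes "f \<in> L2 Lx Ly" "0 < e"
  obtains p where "p \<in> trig" "L2norm Lx Ly (\<lambda>x. f x - p x) < e"
proof -
  have "0 < e\<^sup>2" using assms(2) by simp
  then obtain p where "p \<in> trig" "(LINT x|M. (f x - p x)\<^sup>2) < e\<^sup>2"
    using trig_approx_L2[OF assms(1)] unfolding trig_approx_def by blast
  moreover have "L2norm Lx Ly (\<lambda>x. f x - p x) < e"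
    using real_sqrt_less_mono[OF calculation(2)] assms(2) by (simp add: L2norm_def)
  ultimately show ?thesis using that by blast
qed

section \<open>Divergence-free fields\<close>

text \<open>The Helmholtz-Hodge decomposition on the torus; \<open>c\<close> is the harmonic
  part.\<close>

definition helmholtz :: "(plane \<Rightarrow> plane) \<Rightarrow> bool" where
  "helmholtz P \<longleftrightarrow> (\<exists>c. \<exists>q\<in>trig. \<exists>r\<in>trig. \<forall>v. P v = c + grad q v + perp (grad r v))"

lemma helmholtz_add:
  assumes "helmholtz P" "helmholtz Q" shows "helmholtz (\<lambda>v. P v + Q v)"
proof -
  obtain c q r where 1: "q \<in> trig" "r \<in> trig" "\<And>v. P v = c + grad q v + perp (grad r v)"
    using assms(1) unfolding helmholtz_def by blast
  obtain c' q' r' where 2: "q' \<in> trig" "r' \<in> trig" "\<And>v. Q v = c' + grad q' v + perp (grad r' v)"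
    using assms(2) unfolding helmholtz_def by blast
  have "P v + Q v = (c + c') + grad (\<lambda>v. q v + q' v) v + perp (grad (\<lambda>v. r v + r' v) v)" for v
    using 1 2 by (simp add: grad_add differentiable_trig perp_add algebra_simps)
  then show ?thesis
    unfolding helmholtz_def using 1 2 trig_add by blast
qed

text \<open>For a nonzero wave vector \<open>k\<close>, the vectors \<open>k\<close> and
  \<open>perp k\<close> form an orthogonal basis of the plane. Splitting the amplitude
  \<open>b\<close> along them yields the gradient part and the rotated gradient part; the zero mode
  goes into the constant.\<close>

lemma helmholtz_mode: "helmholtz (\<lambda>v. mode m n \<theta> v *\<^sub>R b)"
proof (cases "m = 0 \<and> n = 0")
  case True
  then have "mode m n \<theta> v *\<^sub>R b = cos \<theta> *\<^sub>R b + grad (\<lambda>v. 0) v + perp (grad (\<lambda>v. 0) v)" for v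
    by (simp add: mode_zero grad_const perp_def zero_prod_def)
  then show ?thesis unfolding helmholtz_def using trig_const[of 0] by blast
next
  case False
  define k1 k2 where "k1 = 2 * pi * of_int m / Lx" and "k2 = 2 * pi * of_int n / Ly"
  define D where "D = k1\<^sup>2 + k2\<^sup>2"
  have D: "D \<noteq> 0"
    using False Lx Ly by (simp add: D_def k1_def k2_def sum_power2_eq_zero_iff)
  \<comment> \<open>These are the coordinates of \<open>b\<close> in the basis \<open>k\<close>,
    \<open>perp k\<close>: the inner products with the two vectors, divided by their common squared
    length \<open>D\<close>.\<close>
  let ?\<alpha> = "(k1 * fst b + k2 * snd b) / D" and ?\<beta> = "(k1 * snd b - k2 * fst b) / D"
  have comp: "k1 * ?\<alpha> - k2 * ?\<beta> = fst b" "k2 * ?\<alpha> + k1 * ?\<beta> = snd b"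
    using D by (simp_all add: field_simps) (simp_all add: D_def power2_eq_square algebra_simps)
  \<comment> \<open>The potential starts at phase \<open>\<theta> - pi / 2\<close>, so that the
    shift caused by differentiation lands on \<open>\<theta>\<close>.\<close>
  have grad: "grad (\<lambda>v. a * mode m n (\<theta> - pi / 2) v) v = (a * mode m n \<theta> v) *\<^sub>R (k1, k2)" for a v
    unfolding grad_mode by (simp add: k1_def k2_def)
  have "mode m n \<theta> v *\<^sub>R b = 0 + grad (\<lambda>v. ?\<alpha> * mode m n (\<theta> - pi / 2) v) v
      + perp (grad (\<lambda>v. ?\<beta> * mode m n (\<theta> - pi / 2) v) v)" for v
  proof -
    have "mode m n \<theta> v *\<^sub>R b = mode m n \<theta> v *\<^sub>R (k1 * ?\<alpha> - k2 * ?\<beta>, k2 * ?\<alpha> + k1 * ?\<beta>)"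
      unfolding comp by simp
    also have "\<dots> = 0 + (?\<alpha> * mode m n \<theta> v) *\<^sub>R (k1, k2) + perp ((?\<beta> * mode m n \<theta> v) *\<^sub>R (k1, k2))"
      by (simp add: perp_def algebra_simps)
    finally show ?thesis unfolding grad .
  qed
  then show ?thesis
    unfolding helmholtz_def using trig_mode by blast
qed

lemma helmholtz_trig:
  assumes "p \<in> trig" shows "helmholtz (\<lambda>v. p v *\<^sub>R b)"
  using assms
proof (induction rule: trig.induct)
  case (trig_mode a m n \<theta>)
  then show ?case using helmholtz_mode[of m n \<theta> "a *\<^sub>R b"] by (simp add: mult.commute)
qed (simp add: helmholtz_add scaleR_left_distrib)

lemma helmholtz_trig_pair:
  assumes "p \<in> trig" "q \<in> trig" shows "helmholtz (\<lambda>v. (p v, q v))"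
  using helmholtz_add[OF helmholtz_trig[OF assms(1), of "(1, 0)"] helmholtz_trig[OF assms(2), of "(0, 1)"]]
  by simp

lemma ip_perp_perp: "ip (\<lambda>x. perp (u x)) (\<lambda>x. perp (v x)) = ip u v"
  by (simp add: ip_def perp_def inner_prod_def add.commute)

text \<open>
  Approximating \<open>z\<close> by a trigonometric field and discarding the constant and gradient parts of the
  latter only improves the approximation, because \<open>z\<close> is orthogonal to these parts. Hence \<open>z\<close> is a
  limit of fields \<open>perp (grad r)\<close>, and these are orthogonal to \<open>perp u\<close>.
\<close>

lemma divfree_ip_perp_eq_0:
  assumes z: "z \<in> L2 Lx Ly" and u: "u \<in> L2 Lx Ly"
    and z_div: "\<And>\<phi>. \<phi> \<in> trig \<Longrightarrow> ip z (grad \<phi>) = 0"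
    and u_div: "\<And>\<phi>. \<phi> \<in> trig \<Longrightarrow> ip u (grad \<phi>) = 0"
    and mean: "(LINT x|M. z x) = 0"
  shows "ip z (\<lambda>x. perp (u x)) = 0"
proof (rule eq_0_if_le_eps)
  fix e :: real assume e: "0 < e"
  have z12: "(\<lambda>x. fst (z x)) \<in> L2 Lx Ly" "(\<lambda>x. snd (z x)) \<in> L2 Lx Ly"
    using L2_bounded_linear[OF bounded_linear_fst z] L2_bounded_linear[OF bounded_linear_snd z] by auto
  obtain p1 where p1: "p1 \<in> trig" "L2norm Lx Ly (\<lambda>x. fst (z x) - p1 x) < e / 2"
    using trig_dense[OF z12(1), of "e / 2"] e by auto
  obtain p2 where p2: "p2 \<in> trig" "L2norm Lx Ly (\<lambda>x. snd (z x) - p2 x) < e / 2"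
    using trig_dense[OF z12(2), of "e / 2"] e by auto
  obtain c q r where q: "q \<in> trig" and r: "r \<in> trig"
    and hh: "\<And>v. (p1 v, p2 v) = c + grad q v + perp (grad r v)"
    using helmholtz_trig_pair[OF p1(1) p2(1)] unfolding helmholtz_def by blast
  define s where "s = (\<lambda>v. perp (grad r v))"
  define g where "g = (\<lambda>v. c + grad q v)"
  define d where "d = (\<lambda>v. z v - s v)"
  have gq: "grad q \<in> L2 Lx Ly" and gr: "grad r \<in> L2 Lx Ly"
    using q r by (simp_all add: L2_grad_trig)
  have s: "s \<in> L2 Lx Ly" unfolding s_def using gr by (rule L2_perp)
  have g: "g \<in> L2 Lx Ly" unfolding g_def by (intro L2_add L2_const gq)
  have d: "d \<in> L2 Lx Ly" unfolding d_def by (intro L2_diff z s)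
  \<comment> \<open>Orthogonality is needed for \<open>z\<close> and for \<open>s\<close>
    separately: for \<open>z\<close> by its zero mean and weak divergence, for \<open>s\<close>
    because gradients have zero mean and Jacobians integrate to zero.\<close>
  have dg: "ip d g = 0"
  proof -
    have "(LINT x|M. s x) = perp (LINT x|M. grad r x)"
      unfolding s_def by (rule integral_bounded_linear[OF bounded_linear_perp L2_integrable[OF gr]])
    then have s0: "(LINT x|M. s x) = 0"
      by (simp add: LINT_grad_trig[OF r] perp_def zero_prod_def)
    have "ip (\<lambda>x. c) z = 0" "ip (\<lambda>x. c) s = 0"
      by (simp_all add: ip_const_left z s mean s0)
    moreover have "ip z (grad q) = 0" "ip s (grad q) = 0"
      using z_div[OF q] ip_perp_grad_grad[OF r q] by (simp_all add: s_def)
    ultimately show ?thesis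
      using z s gq unfolding d_def g_def
      by (simp add: ip_diff_left ip_add_right L2_add ip_commute[of _ "\<lambda>x. c"])
  qed
  have d_le: "L2norm Lx Ly d \<le> e"
  proof (rule power2_le_imp_le)
    \<comment> \<open>\<open>d - g\<close> is the whole error of approximating \<open>z\<close> by
      \<open>(p1, p2)\<close>, and by Pythagoras it is at least as large as \<open>d\<close>. Each
      component contributes at most \<open>(e / 2)^2\<close>.\<close>
    have "ip (\<lambda>x. d x - g x) (\<lambda>x. d x - g x) = ip d d + ip g g"
      using d g dg by (simp add: ip_diff_left ip_diff_right L2_diff ip_commute[of g d])
    then have "(L2norm Lx Ly d)\<^sup>2 \<le> ip (\<lambda>x. d x - g x) (\<lambda>x. d x - g x)"
      using ip_self_nonneg[of g] by (simp add: L2norm_sq)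
    also have "(\<lambda>x. d x - g x) = (\<lambda>x. (fst (z x) - p1 x, snd (z x) - p2 x))"
    proof
      fix x
      have "d x - g x = z x - (p1 x, p2 x)" unfolding hh by (simp add: d_def g_def s_def)
      then show "d x - g x = (fst (z x) - p1 x, snd (z x) - p2 x)" by (cases "z x") simp
    qed
    also have "ip (\<lambda>x. (fst (z x) - p1 x, snd (z x) - p2 x)) (\<lambda>x. (fst (z x) - p1 x, snd (z x) - p2 x))
        = ip (\<lambda>x. fst (z x) - p1 x) (\<lambda>x. fst (z x) - p1 x)
        + ip (\<lambda>x. snd (z x) - p2 x) (\<lambda>x. snd (z x) - p2 x)"
      unfolding ip_def inner_Pair
      by (intro Bochner_Integration.integral_add integrable_inner L2_diff z12 L2_trig p1 p2)
    also have "\<dots> \<le> (e / 2)\<^sup>2 + (e / 2)\<^sup>2"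
      unfolding L2norm_sq[symmetric] using p1 p2 by (intro add_mono power_mono) auto
    also have "\<dots> \<le> e\<^sup>2" by (simp add: power2_eq_square)
    finally show "(L2norm Lx Ly d)\<^sup>2 \<le> e\<^sup>2" .
  qed (use e in simp)
  have "ip z (\<lambda>x. perp (u x)) = ip d (\<lambda>x. perp (u x)) + ip s (\<lambda>x. perp (u x))"
    using ip_add_left[OF d s L2_perp[OF u]] by (simp add: d_def)
  also have "ip s (\<lambda>x. perp (u x)) = 0"
    unfolding s_def ip_perp_perp using u_div[OF r] by (simp add: ip_commute)
  finally have "\<bar>ip z (\<lambda>x. perp (u x))\<bar> \<le> L2norm Lx Ly d * L2norm Lx Ly (\<lambda>x. perp (u x))"
    using ip_Cauchy_Schwarz[OF d L2_perp[OF u]] by simp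
  also have "\<dots> \<le> e * L2norm Lx Ly (\<lambda>x. perp (u x))"
    by (intro mult_right_mono d_le) simp
  finally show "\<bar>ip z (\<lambda>x. perp (u x))\<bar> \<le> e * L2norm Lx Ly (\<lambda>x. perp (u x))" .
qed

section \<open>Weak divergence tested on trigonometric polynomials\<close>

lemma Hdiv_L2: "u \<in> Hdiv Lx Ly \<Longrightarrow> u \<in> L2 Lx Ly"
  by (simp add: Hdiv_def)

lemma is_weak_div_wdiv: "u \<in> Hdiv Lx Ly \<Longrightarrow> is_weak_div Lx Ly u (wdiv Lx Ly u)"
  using someI_ex[of "is_weak_div Lx Ly u"] by (simp add: Hdiv_def wdiv_def)

text \<open>This replaces the chosen representative \<open>wdiv\<close> by a condition linear in
  \<open>u\<close>. For the converse direction, the divergence is orthogonal to all trigonometric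
  polynomials, and these are dense.\<close>

lemma wdiv_eq_0_iff:
  assumes u: "u \<in> Hdiv Lx Ly"
  shows "ae_eq Lx Ly (wdiv Lx Ly u) (\<lambda>x. 0) \<longleftrightarrow> (\<forall>\<phi>\<in>trig. ip u (grad \<phi>) = 0)"
proof -
  let ?d = "wdiv Lx Ly u"
  have d: "?d \<in> L2 Lx Ly"
    using is_weak_div_wdiv[OF u] by (simp add: is_weak_div_def)
  have eq: "ip u (grad \<phi>) = - ip ?d \<phi>" if "\<phi> \<in> trig" for \<phi>
    using is_weak_div_wdiv[OF u] test_function_trig[OF that]
    by (simp add: is_weak_div_def ip_def mult.commute)
  show ?thesis
  proof
    assume "ae_eq Lx Ly ?d (\<lambda>x. 0)"
    then show "\<forall>\<phi>\<in>trig. ip u (grad \<phi>) = 0"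
      by (simp add: eq ip_zero_AE_left)
  next
    assume *: "\<forall>\<phi>\<in>trig. ip u (grad \<phi>) = 0"
    have "ip ?d ?d = 0"
    proof (rule eq_0_if_le_eps)
      fix e :: real assume "0 < e"
      then obtain p where p: "p \<in> trig" "L2norm Lx Ly (\<lambda>x. ?d x - p x) < e"
        using trig_dense[OF d] by blast
      \<comment> \<open>Subtracting \<open>p\<close> costs nothing because \<open>?d\<close> is
        orthogonal to it, and it makes the second factor small.\<close>
      have "ip ?d ?d = ip ?d (\<lambda>x. ?d x - p x)"
        using * p(1) eq[OF p(1)] d L2_trig[OF p(1)] by (simp add: ip_diff_right)
      also have "\<bar>\<dots>\<bar> \<le> L2norm Lx Ly ?d * L2norm Lx Ly (\<lambda>x. ?d x - p x)"
        by (intro ip_Cauchy_Schwarz d L2_diff L2_trig p)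
      also have "\<dots> \<le> L2norm Lx Ly ?d * e"
        using p(2) by (intro mult_left_mono) auto
      finally show "\<bar>ip ?d ?d\<bar> \<le> e * L2norm Lx Ly ?d" by (simp add: mult.commute)
    qed
    then show "ae_eq Lx Ly ?d (\<lambda>x. 0)" by (rule ip_self_eq_0D[OF d])
  qed
qed

section \<open>Constant fields and spatial means\<close>

lemma ip_const_grad_trig: "\<phi> \<in> trig \<Longrightarrow> ip (\<lambda>x. c) (grad \<phi>) = 0"
  by (simp add: ip_const_left L2_grad_trig LINT_grad_trig)

definition mean :: "(plane \<Rightarrow> plane) \<Rightarrow> plane" where
  "mean v = (1 / area) *\<^sub>R (LINT x|M. v x)"

lemma ip_const_mean: "v \<in> L2 Lx Ly \<Longrightarrow> ip (\<lambda>x. c) v = area * (c \<bullet> mean v)"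
  using area_pos by (simp add: ip_const_left mean_def)

lemma LINT_minus_mean:
  assumes "v \<in> L2 Lx Ly" shows "(LINT x|M. v x - mean v) = 0"
  using area_pos by (simp add: L2_integrable[OF assms] mean_def)

lemma mean_diff: "u \<in> L2 Lx Ly \<Longrightarrow> v \<in> L2 Lx Ly \<Longrightarrow> mean (\<lambda>x. u x - v x) = mean u - mean v"
  by (simp add: mean_def L2_integrable scaleR_right_diff_distrib)

lemma mean_scaleR: "mean (\<lambda>x. a *\<^sub>R v x) = a *\<^sub>R mean v"
  by (simp add: mean_def)

lemma mean_perp: "u \<in> L2 Lx Ly \<Longrightarrow> mean (\<lambda>x. perp (u x)) = perp (mean u)"
  by (simp add: mean_def integral_bounded_linear[OF bounded_linear_perp] L2_integrable perp_scaleR)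

text \<open>Cauchy-Schwarz against the constant field \<open>mean v\<close>. Continuity of the mean
  in \<open>L2\<close> is what lets it pass through limits of difference quotients.\<close>

lemma norm_mean_le:
  assumes v: "v \<in> L2 Lx Ly" shows "norm (mean v) \<le> L2norm Lx Ly v / sqrt area"
proof (cases "mean v = 0")
  case False
  have "area * (norm (mean v))\<^sup>2 = ip (\<lambda>x. mean v) v"
    by (simp add: ip_const_mean[OF v] power2_norm_eq_inner)
  also have "\<dots> \<le> (sqrt area * norm (mean v)) * L2norm Lx Ly v"
    using ip_Cauchy_Schwarz[OF L2_const v, of "mean v"] by (simp add: L2norm_const)
  also have "area * (norm (mean v))\<^sup>2 = (sqrt area * norm (mean v))\<^sup>2"
    using area_pos by (simp add: power_mult_distrib)
  finally have "(sqrt area * norm (mean v)) * (sqrt area * norm (mean v))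
      \<le> (sqrt area * norm (mean v)) * L2norm Lx Ly v"
    unfolding power2_eq_square .
  then have "sqrt area * norm (mean v) \<le> L2norm Lx Ly v"
    using area_pos False by (simp add: mult_le_cancel_left)
  then show ?thesis using area_pos by (simp add: field_simps)
qed (use area_pos in simp)

section \<open>Solutions of the discrete equations\<close>

lemma has_time_deriv_cong:
  assumes "has_time_deriv Lx Ly T u ut t" "t \<in> T"
    and "\<And>s. s \<in> T \<Longrightarrow> u s \<in> L2 Lx Ly" "\<And>s. s \<in> T \<Longrightarrow> v s \<in> L2 Lx Ly"
    and "\<And>s. s \<in> T \<Longrightarrow> ae_eq Lx Ly (u s) (v s)"
  shows "has_time_deriv Lx Ly T v ut t"
proof -
  have ut: "ut \<in> L2 Lx Ly" using assms(1) by (simp add: has_time_deriv_def)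
  have "L2norm Lx Ly (\<lambda>x. (1 / (s - t)) *\<^sub>R (u s x - u t x) - ut x)
      = L2norm Lx Ly (\<lambda>x. (1 / (s - t)) *\<^sub>R (v s x - v t x) - ut x)" if s: "s \<in> T" for s
  proof (rule L2norm_cong_AE)
    show "ae_eq Lx Ly (\<lambda>x. (1 / (s - t)) *\<^sub>R (u s x - u t x) - ut x)
        (\<lambda>x. (1 / (s - t)) *\<^sub>R (v s x - v t x) - ut x)"
      using assms(5)[OF s] assms(5)[OF assms(2)] unfolding ae_eq_def by eventually_elim simp
  qed (use assms s ut in \<open>auto intro!: L2_diff L2_scaleR\<close>)
  then have "\<forall>\<^sub>F s in at t within T. L2norm Lx Ly (\<lambda>x. (1 / (s - t)) *\<^sub>R (u s x - u t x) - ut x)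
      = L2norm Lx Ly (\<lambda>x. (1 / (s - t)) *\<^sub>R (v s x - v t x) - ut x)"
    by (intro eventually_mono[OF eventually_in_within]) blast
  then show ?thesis
    using assms(1) ut unfolding has_time_deriv_def by (auto intro: Lim_transform_eventually)
qed

text \<open>By Cauchy-Schwarz the error of the scalar difference quotient is bounded by that of the
  \<open>L2\<close> difference quotient times the norm of \<open>w\<close>.\<close>

lemma has_time_deriv_ip:
  assumes u: "has_time_deriv Lx Ly T u ut t" "t \<in> T" "\<And>s. s \<in> T \<Longrightarrow> u s \<in> L2 Lx Ly"
    and w: "w \<in> L2 Lx Ly"
  shows "((\<lambda>s. ip w (u s)) has_field_derivative ip w ut) (at t within T)"
  unfolding has_field_derivative_iff
proof (rule Lim_null[THEN iffD2], rule Lim_null_comparison)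
  have ut: "ut \<in> L2 Lx Ly" using u(1) by (simp add: has_time_deriv_def)
  have "norm ((ip w (u s) - ip w (u t)) / (s - t) - ip w ut)
      \<le> L2norm Lx Ly w * L2norm Lx Ly (\<lambda>x. (1 / (s - t)) *\<^sub>R (u s x - u t x) - ut x)"
    if s: "s \<in> T" for s
  proof -
    have "ip w (\<lambda>x. (1 / (s - t)) *\<^sub>R (u s x - u t x) - ut x)
        = (ip w (u s) - ip w (u t)) / (s - t) - ip w ut"
      using u(3)[OF s] u(3)[OF u(2)] w ut
      by (simp add: ip_diff_right L2_diff L2_scaleR ip_scaleR_right)
    then show ?thesis
      using ip_Cauchy_Schwarz[OF w, of "\<lambda>x. (1 / (s - t)) *\<^sub>R (u s x - u t x) - ut x"]
        u(3)[OF s] u(3)[OF u(2)] ut by (simp add: L2_diff L2_scaleR)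
  qed
  then show "\<forall>\<^sub>F s in at t within T. norm ((ip w (u s) - ip w (u t)) / (s - t) - ip w ut)
      \<le> L2norm Lx Ly w * L2norm Lx Ly (\<lambda>x. (1 / (s - t)) *\<^sub>R (u s x - u t x) - ut x)"
    by (intro eventually_mono[OF eventually_in_within]) blast
  show "((\<lambda>s. L2norm Lx Ly w * L2norm Lx Ly (\<lambda>x. (1 / (s - t)) *\<^sub>R (u s x - u t x) - ut x))
      \<longlongrightarrow> 0) (at t within T)"
    using u(1) by (auto simp: has_time_deriv_def intro: tendsto_mult_right_zero)
qed

text \<open>At an isolated time every square-integrable field would qualify as a derivative, hence
  \<open>t islimpt T\<close>. The two candidates are compared by pairing with their own
  difference.\<close>

lemma has_time_deriv_unique:
  assumes "has_time_deriv Lx Ly T u ut t" "has_time_deriv Lx Ly T u ut' t"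
    and t: "t \<in> T" "t islimpt T" and u: "\<And>s. s \<in> T \<Longrightarrow> u s \<in> L2 Lx Ly"
  shows "ae_eq Lx Ly ut ut'"
proof -
  have L: "ut \<in> L2 Lx Ly" "ut' \<in> L2 Lx Ly"
    using assms by (simp_all add: has_time_deriv_def)
  let ?w = "\<lambda>x. ut x - ut' x"
  have w: "?w \<in> L2 Lx Ly" using L by (rule L2_diff)
  have "at t within T \<noteq> bot" using t(2) by (simp add: trivial_limit_within)
  then have "ip ?w ut = ip ?w ut'"
    using has_time_deriv_ip[OF assms(1) t(1) u w] has_time_deriv_ip[OF assms(2) t(1) u w]
    unfolding has_field_derivative_iff by (rule tendsto_unique)
  then have "ip ?w ?w = 0" by (simp add: ip_diff_right[OF L w])
  then show ?thesis using ip_self_eq_0D[OF w] by (simp add: ae_eq_def)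
qed

lemma has_time_deriv_const:
  assumes "((\<lambda>s. (1 / (s - t)) *\<^sub>R (c s - c t)) \<longlongrightarrow> c') (at t within T)"
  shows "has_time_deriv Lx Ly T (\<lambda>s x. c s) (\<lambda>x. c') t"
proof -
  have "((\<lambda>s. sqrt area * norm ((1 / (s - t)) *\<^sub>R (c s - c t) - c')) \<longlongrightarrow> 0) (at t within T)"
    using assms by (intro tendsto_mult_right_zero tendsto_norm_zero) (simp add: Lim_null[symmetric])
  then show ?thesis by (simp add: has_time_deriv_def L2norm_const)
qed

lemma has_time_deriv_zero: "has_time_deriv Lx Ly T (\<lambda>s. v) (\<lambda>x. 0) t"
  by (simp add: has_time_deriv_def L2norm_const)

lemma has_time_deriv_mean:
  assumes u: "has_time_deriv Lx Ly T u ut t" "t \<in> T" "\<And>s. s \<in> T \<Longrightarrow> u s \<in> L2 Lx Ly"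
  shows "((\<lambda>s. (1 / (s - t)) *\<^sub>R (mean (u s) - mean (u t))) \<longlongrightarrow> mean ut) (at t within T)"
proof (rule Lim_null[THEN iffD2], rule Lim_null_comparison)
  have ut: "ut \<in> L2 Lx Ly" using u(1) by (simp add: has_time_deriv_def)
  have "norm ((1 / (s - t)) *\<^sub>R (mean (u s) - mean (u t)) - mean ut)
      \<le> L2norm Lx Ly (\<lambda>x. (1 / (s - t)) *\<^sub>R (u s x - u t x) - ut x) / sqrt area"
    if s: "s \<in> T" for s
  proof -
    have L: "u s \<in> L2 Lx Ly" "u t \<in> L2 Lx Ly" using u s by auto
    show ?thesis
      using norm_mean_le[of "\<lambda>x. (1 / (s - t)) *\<^sub>R (u s x - u t x) - ut x"] L ut
      by (simp add: mean_diff L2_diff L2_scaleR mean_scaleR)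
  qed
  then show "\<forall>\<^sub>F s in at t within T. norm ((1 / (s - t)) *\<^sub>R (mean (u s) - mean (u t)) - mean ut)
      \<le> L2norm Lx Ly (\<lambda>x. (1 / (s - t)) *\<^sub>R (u s x - u t x) - ut x) / sqrt area"
    by (intro eventually_mono[OF eventually_in_within]) blast
  show "((\<lambda>s. L2norm Lx Ly (\<lambda>x. (1 / (s - t)) *\<^sub>R (u s x - u t x) - ut x) / sqrt area)
      \<longlongrightarrow> 0) (at t within T)"
    using u(1) by (auto simp: has_time_deriv_def intro: tendsto_divide_zero)
qed

section \<open>Divergence-free solutions with vanishing height, expressed by inner products\<close>

lemma divfree_flat_solutionD:
  assumes "divfree_flat_solution Lx Ly V1 V2 g H (\<lambda>x. f) T u h" "t \<in> T"
  shows "u t \<in> V1" "ae_eq Lx Ly (wdiv Lx Ly (u t)) (\<lambda>x. 0)"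
    "\<exists>ut. has_time_deriv Lx Ly T u ut t \<and>
      (\<forall>w\<in>V1. ip w ut + f * ip w (\<lambda>x. perp (u t x)) = 0)"
proof -
  have h: "ae_eq Lx Ly (h t) (\<lambda>x. 0)"
    using assms by (simp add: divfree_flat_solution_def)
  obtain ut where ut: "has_time_deriv Lx Ly T u ut t"
    "\<forall>w\<in>V1. (LINT x|M. w x \<bullet> ut x) + (LINT x|M. f * (w x \<bullet> perp (u t x)))
       - g * (LINT x|M. wdiv Lx Ly w x * h t x) = 0"
    using assms unfolding divfree_flat_solution_def swe_solution_def by blast
  have "(LINT x|M. wdiv Lx Ly w x * h t x) = 0" for w
    using h unfolding ae_eq_def by (intro integral_eq_zero_AE) (auto elim: eventually_mono)
  then show "\<exists>ut. has_time_deriv Lx Ly T u ut t \<and>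
      (\<forall>w\<in>V1. ip w ut + f * ip w (\<lambda>x. perp (u t x)) = 0)"
    using ut by (intro exI[of _ ut]) (simp add: ip_def)
  show "u t \<in> V1" "ae_eq Lx Ly (wdiv Lx Ly (u t)) (\<lambda>x. 0)"
    using assms by (auto simp: divfree_flat_solution_def swe_solution_def)
qed

lemma divfree_flat_solutionI:
  assumes "(\<lambda>x. 0) \<in> V2"
    and "\<And>t. t \<in> T \<Longrightarrow> u t \<in> V1"
    and "\<And>t. t \<in> T \<Longrightarrow> ae_eq Lx Ly (wdiv Lx Ly (u t)) (\<lambda>x. 0)"
    and "\<And>t. t \<in> T \<Longrightarrow> \<exists>ut. has_time_deriv Lx Ly T u ut t \<and>
      (\<forall>w\<in>V1. ip w ut + f * ip w (\<lambda>x. perp (u t x)) = 0)"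
  shows "divfree_flat_solution Lx Ly V1 V2 g H (\<lambda>x. f) T u (\<lambda>t x. 0)"
proof -
  have zero: "(LINT x|M. \<phi> x * (0 + H * wdiv Lx Ly (u t) x)) = 0" if "t \<in> T" for t \<phi>
    using assms(3)[OF that] unfolding ae_eq_def
    by (intro integral_eq_zero_AE) (auto elim: eventually_mono)
  have "\<exists>ut ht. has_time_deriv Lx Ly T u ut t \<and> has_time_deriv Lx Ly T (\<lambda>t x. 0 :: real) ht t \<and>
      (\<forall>w\<in>V1. (LINT x|M. w x \<bullet> ut x) + (LINT x|M. f * (w x \<bullet> perp (u t x)))
         - g * (LINT x|M. wdiv Lx Ly w x * 0) = 0) \<and>
      (\<forall>\<phi>\<in>V2. (LINT x|M. \<phi> x * (ht x + H * wdiv Lx Ly (u t) x)) = 0)" if t: "t \<in> T" for t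
  proof -
    obtain ut where "has_time_deriv Lx Ly T u ut t"
      "\<forall>w\<in>V1. ip w ut + f * ip w (\<lambda>x. perp (u t x)) = 0" using assms(4)[OF t] by blast
    then show ?thesis
      using zero[OF t] has_time_deriv_zero by (intro exI[of _ ut] exI[of _ "\<lambda>x. 0"]) (simp add: ip_def)
  qed
  with assms show ?thesis
    by (auto simp: divfree_flat_solution_def swe_solution_def ae_eq_def)
qed

end

text \<open>With constants in \<open>V1\<close>, subtracting a mean does not leave the space and
  spatially constant fields are admissible velocities. The interior of \<open>T\<close> excludes a
  single instant, at which time derivatives would carry no information.\<close>

locale compatible_plane = periodic_plane Lx Ly for Lx Ly :: real +
  fixes V0 V1 V2 and T :: "real set"
  assumes compatible: "compatible_fe_spaces Lx Ly V0 V1 V2"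
    and constants: "\<And>c. (\<lambda>x. c) \<in> V1"
    and T_interval: "is_interval T" and T_interior: "interior T \<noteq> {}"
begin

lemma V1_Hdiv: "u \<in> V1 \<Longrightarrow> u \<in> Hdiv Lx Ly"
  using compatible by (auto simp: compatible_fe_spaces_def fe_space_def)

lemma V1_L2: "u \<in> V1 \<Longrightarrow> u \<in> L2 Lx Ly"
  using V1_Hdiv Hdiv_L2 by blast

lemma V1_diff:
  assumes "u \<in> V1" "v \<in> V1" shows "(\<lambda>x. u x - v x) \<in> V1"
proof -
  have add: "\<And>u v. u \<in> V1 \<Longrightarrow> v \<in> V1 \<Longrightarrow> (\<lambda>x. u x + v x) \<in> V1"
    and scale: "\<And>u a. u \<in> V1 \<Longrightarrow> (\<lambda>x. a *\<^sub>R u x) \<in> V1"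
    using compatible by (auto simp: compatible_fe_spaces_def fe_space_def)
  show ?thesis using add[OF assms(1) scale[OF assms(2), of "-1"]] by simp
qed

lemma V2_zero: "(\<lambda>x. 0) \<in> V2"
  using compatible by (auto simp: compatible_fe_spaces_def fe_space_def)

lemma islimpt_T: "t \<in> T \<Longrightarrow> t islimpt T"
proof (rule connected_imp_perfect[OF is_interval_connected[OF T_interval]])
  show "T \<noteq> {x}" for x using T_interior by auto
qed

definition divfree :: "(plane \<Rightarrow> plane) \<Rightarrow> bool" where
  "divfree u \<longleftrightarrow> u \<in> V1 \<and> ae_eq Lx Ly (wdiv Lx Ly u) (\<lambda>x. 0)"

lemma divfree_iff: "divfree u \<longleftrightarrow> u \<in> V1 \<and> (\<forall>\<phi>\<in>trig. ip u (grad \<phi>) = 0)"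
  using wdiv_eq_0_iff[OF V1_Hdiv] by (auto simp: divfree_def)

lemma divfree_const: "divfree (\<lambda>x. c)"
  by (simp add: divfree_iff constants ip_const_grad_trig)

lemma divfree_diff: "divfree u \<Longrightarrow> divfree v \<Longrightarrow> divfree (\<lambda>x. u x - v x)"
  by (simp add: divfree_iff V1_diff ip_diff_left V1_L2 L2_grad_trig)

lemma divfree_L2: "divfree u \<Longrightarrow> u \<in> L2 Lx Ly"
  by (simp add: divfree_def V1_L2)

text \<open>Both the test field and the conclusion concern the same pair of times: \<open>z\<close>
  is the change of the fluctuation itself, and conservation of its pairing with \<open>u\<close>
  makes it orthogonal to itself.\<close>

lemma fluctuation_conserved:
  assumes sol: "divfree_flat_solution Lx Ly V1 V2 g H (\<lambda>x. f) T u h" and st: "s \<in> T" "t \<in> T"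
  shows "ae_eq Lx Ly (\<lambda>x. u s x - mean (u s)) (\<lambda>x. u t x - mean (u t))"
proof -
  note D = divfree_flat_solutionD[OF sol]
  have u: "divfree (u r)" if "r \<in> T" for r
    using D[OF that] by (simp add: divfree_def)
  have uL: "u r \<in> L2 Lx Ly" if "r \<in> T" for r
    using divfree_L2[OF u[OF that]] .
  define d where "d = (\<lambda>x. u s x - u t x)"
  define z where "z = (\<lambda>x. d x - mean d)"
  have d: "d \<in> L2 Lx Ly" unfolding d_def by (intro L2_diff uL st)
  have z: "divfree z" unfolding z_def d_def by (intro divfree_diff divfree_const u st)
  have zL: "z \<in> L2 Lx Ly" using divfree_L2[OF z] .
  have z0: "(LINT x|M. z x) = 0" unfolding z_def by (rule LINT_minus_mean[OF d])
  \<comment> \<open>\<open>z\<close> depends on \<open>s\<close> and \<open>t\<close> but stays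
    fixed while \<open>r\<close> runs through \<open>T\<close>; it is divergence-free and of zero
    mean, so the Coriolis term vanishes at every \<open>r\<close>.\<close>
  have "((\<lambda>r. ip z (u r)) has_field_derivative 0) (at r within T)" if r: "r \<in> T" for r
  proof -
    obtain ut where ut: "has_time_deriv Lx Ly T u ut r"
      "\<And>w. w \<in> V1 \<Longrightarrow> ip w ut + f * ip w (\<lambda>x. perp (u r x)) = 0"
      using D(3)[OF r] by blast
    have "ip z (\<lambda>x. perp (u r x)) = 0"
      using z u[OF r] by (intro divfree_ip_perp_eq_0 z0 zL uL r) (auto simp: divfree_iff)
    then have "ip z ut = 0" using ut(2)[of z] z by (simp add: divfree_def)
    then show ?thesis using has_time_deriv_ip[OF ut(1) r uL zL] by simp
  qed
  then obtain c where "\<And>r. r \<in> T \<Longrightarrow> ip z (u r) = c"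
    using has_field_derivative_zero_constant[of T "\<lambda>r. ip z (u r)"] T_interval
    by (auto simp: is_interval_convex_1)
  \<comment> \<open>The conserved pairing has the same value at \<open>s\<close> and at
    \<open>t\<close>. Since \<open>z\<close> is also orthogonal to the constant by which it differs
    from \<open>d\<close>, its norm vanishes.\<close>
  then have "ip z d = 0" unfolding d_def by (simp add: ip_diff_right uL zL st)
  moreover have "ip z (\<lambda>x. mean d) = 0"
    by (simp add: ip_commute[of z] ip_const_left[OF zL] z0)
  ultimately have "ip z z = 0"
    using ip_diff_right[OF d L2_const zL, of "mean d"] by (simp add: z_def)
  then have "ae_eq Lx Ly z (\<lambda>x. 0)" by (rule ip_self_eq_0D[OF zL])
  then show ?thesis
    unfolding ae_eq_def z_def d_def mean_diff[OF uL[OF st(1)] uL[OF st(2)]]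
    by eventually_elim (simp add: algebra_simps)
qed

text \<open>Testing the momentum equation with constant fields yields a closed equation for the
  mean.\<close>

lemma mean_inertial:
  assumes "ut \<in> L2 Lx Ly" "u \<in> L2 Lx Ly"
    and "\<And>w. w \<in> V1 \<Longrightarrow> ip w ut + f * ip w (\<lambda>x. perp (u x)) = 0"
  shows "mean ut = - (f *\<^sub>R perp (mean u))"
proof -
  have "b \<bullet> mean ut = b \<bullet> (- (f *\<^sub>R perp (mean u)))" for b
  proof -
    have "area * (b \<bullet> mean ut + f * (b \<bullet> perp (mean u))) = 0"
      using assms(3)[OF constants[of b]] assms(1,2)
      by (simp add: ip_const_mean L2_perp mean_perp algebra_simps)
    then show ?thesis using area_pos by simp
  qed
  then show ?thesis using vector_eq_ldot by blast
qed

lemma solution_decomposition: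
  assumes sol: "divfree_flat_solution Lx Ly V1 V2 g H (\<lambda>x. f) T u h"
  shows "\<exists>us uc.
           divfree_flat_solution Lx Ly V1 V2 g H (\<lambda>x. f) T us (\<lambda>t x. 0) \<and>
           time_independent Lx Ly T us \<and>
           divfree_flat_solution Lx Ly V1 V2 g H (\<lambda>x. f) T uc (\<lambda>t x. 0) \<and>
           inertial_oscillation Lx Ly f T uc \<and>
           (\<forall>t\<in>T. ae_eq Lx Ly (u t) (\<lambda>x. us t x + uc t x))"
proof -
  note D = divfree_flat_solutionD[OF sol]
  have u: "divfree (u r)" if "r \<in> T" for r
    using D[OF that] by (simp add: divfree_def)
  have uL: "u r \<in> L2 Lx Ly" if "r \<in> T" for r
    using divfree_L2[OF u[OF that]] .
  define c where "c t = mean (u t)" for t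
  define c' where "c' t = - (f *\<^sub>R perp (c t))" for t
  obtain t0 where t0: "t0 \<in> T" using T_interior interior_subset by blast
  \<comment> \<open>The steady part is the fluctuation frozen at an arbitrary time
    \<open>t0\<close>. By conservation any other choice gives the same field almost
    everywhere.\<close>
  define us where "us = (\<lambda>t::real. \<lambda>x. u t0 x - c t0)"
  define uc where "uc = (\<lambda>t. \<lambda>x::plane. c t)"
  have split: "ae_eq Lx Ly (u t) (\<lambda>x. us t x + uc t x)" if "t \<in> T" for t
    using fluctuation_conserved[OF sol that t0] unfolding ae_eq_def us_def uc_def c_def
    by eventually_elim (simp add: algebra_simps)
  have uc_deriv: "has_time_deriv Lx Ly T uc (\<lambda>x. c' t) t" if t: "t \<in> T" for t
  proof -
    obtain ut where ut: "has_time_deriv Lx Ly T u ut t"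
      "\<And>w. w \<in> V1 \<Longrightarrow> ip w ut + f * ip w (\<lambda>x. perp (u t x)) = 0"
      using D(3)[OF t] by blast
    have "mean ut = c' t"
      unfolding c'_def c_def using ut uL[OF t]
      by (intro mean_inertial) (auto simp: has_time_deriv_def)
    then show ?thesis
      using has_time_deriv_const[OF has_time_deriv_mean[OF ut(1) t uL]] by (simp add: uc_def c_def)
  qed
  have us: "divfree (us t)" for t
    unfolding us_def by (intro divfree_diff u divfree_const t0)
  \<comment> \<open>The steady part inherits its equation from time \<open>t0\<close>: there the
    derivative of \<open>u\<close> is the constant \<open>c' t0\<close>, which cancels exactly the
    Coriolis term of the mean and leaves only that of the fluctuation.\<close>
  have us_coriolis: "f * ip w (\<lambda>x. perp (us t x)) = 0" if w: "w \<in> V1" for w t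
  proof -
    obtain ut where ut: "has_time_deriv Lx Ly T u ut t0"
      "\<And>w. w \<in> V1 \<Longrightarrow> ip w ut + f * ip w (\<lambda>x. perp (u t0 x)) = 0"
      using D(3)[OF t0] by blast
    have utL: "ut \<in> L2 Lx Ly" using ut(1) by (simp add: has_time_deriv_def)
    have ucL: "uc r \<in> L2 Lx Ly" for r by (simp add: uc_def)
    have "has_time_deriv Lx Ly T (\<lambda>r x. us t0 x + uc r x) (\<lambda>x. c' t0) t0"
      using uc_deriv[OF t0] by (simp add: has_time_deriv_def)
    then have "has_time_deriv Lx Ly T u (\<lambda>x. c' t0) t0"
    proof (rule has_time_deriv_cong)
      show "ae_eq Lx Ly (\<lambda>x. us t0 x + uc r x) (u r)" if "r \<in> T" for r
        using split[OF that] by (simp add: us_def ae_eq_def eq_commute)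
    qed (use t0 uL ucL us divfree_L2 in auto)
    then have "ae_eq Lx Ly ut (\<lambda>x. c' t0)"
      using has_time_deriv_unique[OF ut(1) _ t0 islimpt_T[OF t0] uL] by blast
    then have "ip w ut = ip w (\<lambda>x. c' t0)"
      using V1_L2[OF w] utL by (intro ip_cong_AE) (auto simp: ae_eq_def)
    then have "ip w (\<lambda>x. - f *\<^sub>R perp (c t0)) + f * ip w (\<lambda>x. perp (u t0 x)) = 0"
      using ut(2)[OF w] by (simp add: c'_def)
    then show ?thesis
      unfolding ip_scaleR_right us_def perp_diff
      using V1_L2[OF w] uL[OF t0] by (simp add: ip_diff_right L2_perp algebra_simps)
  qed
  have "divfree_flat_solution Lx Ly V1 V2 g H (\<lambda>x. f) T us (\<lambda>t x. 0)"
  proof (rule divfree_flat_solutionI[OF V2_zero])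
    have "has_time_deriv Lx Ly T us (\<lambda>x. 0) t" for t
      unfolding us_def by (rule has_time_deriv_zero)
    then show "\<exists>ut. has_time_deriv Lx Ly T us ut t \<and>
        (\<forall>w\<in>V1. ip w ut + f * ip w (\<lambda>x. perp (us t x)) = 0)" for t
      using us_coriolis by (intro exI[of _ "\<lambda>x. 0"]) (simp add: ip_def)
  qed (use us in \<open>auto simp: divfree_def\<close>)
  moreover have "divfree_flat_solution Lx Ly V1 V2 g H (\<lambda>x. f) T uc (\<lambda>t x. 0)"
  proof (rule divfree_flat_solutionI[OF V2_zero])
    fix t assume t: "t \<in> T"
    have "ip w (\<lambda>x. c' t) + f * ip w (\<lambda>x. perp (uc t x)) = 0" for w
      using ip_scaleR_right[of w "- f" "\<lambda>x. perp (c t)"] by (simp add: c'_def uc_def)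
    then show "\<exists>ut. has_time_deriv Lx Ly T uc ut t \<and>
        (\<forall>w\<in>V1. ip w ut + f * ip w (\<lambda>x. perp (uc t x)) = 0)"
      using uc_deriv[OF t] by blast
  qed (use divfree_const in \<open>auto simp: divfree_def uc_def\<close>)
  moreover have "time_independent Lx Ly T us"
    by (simp add: time_independent_def us_def ae_eq_def)
  moreover have "inertial_oscillation Lx Ly f T uc"
    unfolding inertial_oscillation_def
  proof (intro ballI conjI)
    fix t assume t: "t \<in> T"
    show "spatially_constant Lx Ly (uc t)"
      unfolding spatially_constant_def by (intro exI[of _ "c t"]) (simp add: uc_def ae_eq_def)
    have "ae_eq Lx Ly (\<lambda>x. c' t + f *\<^sub>R perp (uc t x)) (\<lambda>x. 0)"
      by (simp add: ae_eq_def uc_def c'_def)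
    then show "\<exists>ut. has_time_deriv Lx Ly T uc ut t \<and>
        ae_eq Lx Ly (\<lambda>x. ut x + f *\<^sub>R perp (uc t x)) (\<lambda>x. 0)"
      using uc_deriv[OF t] by blast
  qed
  ultimately show ?thesis using split by blast
qed

text \<open>Constants have zero weak divergence, and the pointwise equation becomes the weak one
  after pairing with \<open>w\<close>. Each \<open>u t\<close> is constant only almost everywhere,
  so both facts are transferred through \<open>ip\<close>.\<close>

lemma inertial_oscillation_solution:
  assumes V1: "\<And>t. t \<in> T \<Longrightarrow> u t \<in> V1" and osc: "inertial_oscillation Lx Ly f T u"
  shows "divfree_flat_solution Lx Ly V1 V2 g H (\<lambda>x. f) T u (\<lambda>t x. 0)"
proof (rule divfree_flat_solutionI[OF V2_zero V1])
  fix t assume t: "t \<in> T"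
  have uL: "u t \<in> L2 Lx Ly" using V1_L2[OF V1[OF t]] .
  obtain c where c: "ae_eq Lx Ly (u t) (\<lambda>x. c)"
    using osc t by (auto simp: inertial_oscillation_def spatially_constant_def)
  have "ip (u t) (grad \<phi>) = 0" if "\<phi> \<in> trig" for \<phi>
  proof -
    have "ip (u t) (grad \<phi>) = ip (\<lambda>x. c) (grad \<phi>)"
      using c uL L2_grad_trig[OF that] by (intro ip_cong_AE) (auto simp: ae_eq_def)
    then show ?thesis using ip_const_grad_trig[OF that] by simp
  qed
  then show "ae_eq Lx Ly (wdiv Lx Ly (u t)) (\<lambda>x. 0)"
    using wdiv_eq_0_iff[OF V1_Hdiv[OF V1[OF t]]] by simp
  obtain ut where ut: "has_time_deriv Lx Ly T u ut t"
    "ae_eq Lx Ly (\<lambda>x. ut x + f *\<^sub>R perp (u t x)) (\<lambda>x. 0)"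
    using osc t by (auto simp: inertial_oscillation_def)
  have utL: "ut \<in> L2 Lx Ly" using ut(1) by (simp add: has_time_deriv_def)
  have "ip w ut + f * ip w (\<lambda>x. perp (u t x)) = 0" if w: "w \<in> V1" for w
    using ip_zero_AE_left[OF ut(2), of w] uL utL V1_L2[OF w]
    by (simp add: ip_commute[of _ w] ip_add_right L2_perp L2_scaleR ip_scaleR_right)
  then show "\<exists>ut. has_time_deriv Lx Ly T u ut t \<and>
      (\<forall>w\<in>V1. ip w ut + f * ip w (\<lambda>x. perp (u t x)) = 0)"
    using ut(1) by blast
qed

text \<open>By uniqueness the time derivative is zero, so the momentum equation reduces to its
  Coriolis term, and the nonzero constant \<open>f\<close> divides out.\<close>

lemma time_independent_coriolis_kernel:
  assumes sol: "divfree_flat_solution Lx Ly V1 V2 g H (\<lambda>x. f) T u h"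
    and ind: "time_independent Lx Ly T u" and f: "f \<noteq> 0" and t: "t \<in> T"
  shows "u t \<in> coriolis_kernel Lx Ly V1"
proof -
  note D = divfree_flat_solutionD[OF sol]
  have uL: "u r \<in> L2 Lx Ly" if "r \<in> T" for r
    using V1_L2[OF D(1)[OF that]] .
  obtain ut where ut: "has_time_deriv Lx Ly T u ut t"
    "\<And>w. w \<in> V1 \<Longrightarrow> ip w ut + f * ip w (\<lambda>x. perp (u t x)) = 0"
    using D(3)[OF t] by blast
  have "has_time_deriv Lx Ly T u (\<lambda>x. 0) t"
    using has_time_deriv_zero
  proof (rule has_time_deriv_cong)
    show "ae_eq Lx Ly (u t) (u r)" if "r \<in> T" for r
      using ind t that by (simp add: time_independent_def)
  qed (use t uL in auto)
  then have "ae_eq Lx Ly ut (\<lambda>x. 0)"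
    using has_time_deriv_unique[OF ut(1) _ t islimpt_T[OF t] uL] by blast
  then have "ip w ut = 0" for w
    using ip_zero_AE_left[of ut w] by (simp add: ip_commute)
  then have "ip w (\<lambda>x. perp (u t x)) = 0" if "w \<in> V1" for w
    using ut(2)[OF that] f by simp
  then show ?thesis
    using D(1)[OF t] by (simp add: coriolis_kernel_def ip_def)
qed

end

text \<open>The equations are linear, so a steady solution can be added to any other. The claim that
  inertial oscillations are the only time-varying solutions is therefore read modulo steady ones:
  each solution is a steady one plus an inertial oscillation, and conversely each inertial
  oscillation in \<open>V1\<close> is a solution.\<close>

theorem theorem4p2:
  fixes Lx Ly g H f :: real
    and T :: "real set"
    and V0 :: "(plane \<Rightarrow> real) set"
    and V1 :: "(plane \<Rightarrow> plane) set"
    and V2 :: "(plane \<Rightarrow> real) set"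
  assumes "Lx > 0" and "Ly > 0"
    and "compatible_fe_spaces Lx Ly V0 V1 V2"
    and constants: "\<And>c. (\<lambda>x. c) \<in> V1"
    and "f \<noteq> 0"
    and "is_interval T" and "interior T \<noteq> {}"
  shows
    "(\<forall>u h. divfree_flat_solution Lx Ly V1 V2 g H (\<lambda>x. f) T u h \<longrightarrow>
        (\<exists>us uc.
           divfree_flat_solution Lx Ly V1 V2 g H (\<lambda>x. f) T us (\<lambda>t x. 0) \<and>
           time_independent Lx Ly T us \<and>
           divfree_flat_solution Lx Ly V1 V2 g H (\<lambda>x. f) T uc (\<lambda>t x. 0) \<and>
           inertial_oscillation Lx Ly f T uc \<and>
           (\<forall>t\<in>T. ae_eq Lx Ly (u t) (\<lambda>x. us t x + uc t x))))
   \<and> (\<forall>u. (\<forall>t\<in>T. u t \<in> V1) \<and> inertial_oscillation Lx Ly f T u \<longrightarrow>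
        divfree_flat_solution Lx Ly V1 V2 g H (\<lambda>x. f) T u (\<lambda>t x. 0))
   \<and> (\<forall>u h. divfree_flat_solution Lx Ly V1 V2 g H (\<lambda>x. f) T u h \<and> time_independent Lx Ly T u \<longrightarrow>
        (\<forall>t\<in>T. u t \<in> coriolis_kernel Lx Ly V1))"
proof -
  interpret compatible_plane Lx Ly V0 V1 V2 T
    using assms by unfold_locales auto
  show ?thesis
    using solution_decomposition[where f = f and g = g and H = H]
      inertial_oscillation_solution[where f = f and g = g and H = H]
      time_independent_coriolis_kernel[where f = f and g = g and H = H] \<open>f \<noteq> 0\<close>
    by blast
qed

end
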